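(* Let $s_{1,1}\in\mathbb{R}$ with $|s_{1,1}|<1$, and consider the array of parameters $(s_{i,j})_{i,j\ge 0}$ given by $$s_{0,0}=1,\quad s_{2n-1,0}=0,\quad s_{2n,0}=\tfrac12,\quad s_{0,2m-1}=0,\quad s_{0,2m}=\tfrac12,$$ $$s_{2n-1,2m-1}=s_{1,1},\quad s_{2n-1,2m}=0,\quad s_{2n,2m-1}=0,\quad s_{2n,2m}=\tfrac12,$$ for all integers $n,m\ge 1$. Let $\mathbb{P}_{n,m}(x,y)$ ($n,m\ge 0$) be the vector polynomials constructed with these parameters, i.e. the lexicographic orthonormal vector polynomials of the positive definite linear functional on $\mathbb{R}[x,y]$ whose parameters are $(s_{i,j})$. Then they are orthonormal with respect to the measure on $[-1,1]^2$ $$d\mu(x,y)=\frac{4}{\pi^2}\,\frac{(1-s_{1,1}^2)\sqrt{1-x^2}\sqrt{1-y^2}}{4s_{1,1}^2(x^2+y^2)-4s_{1,1}(1+s_{1,1}^2)xy+(1-s_{1,1}^2)^2}\,dx\,dy ,$$ that is, for all $n,k,m\ge 0$, $$\int_{[-1,1]^2}\mathbb{P}_{n,m}(x,y)\,\mathbb{P}_{k,m}(x,y)^t\,d\mu(x,y)=\delta_{n,k}I_{m+1}.$$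
   Context: Let $\mathcal{F}:\mathbb{R}[x,y]\to\mathbb{R}$ be a linear functional that is positive definite, i.e. $\mathcal{F}(f^2)>0$ for all $f\neq 0$. Lexicographic orthonormal polynomials. For $n,m\ge 0$ and $0\le l\le m$, $p_{n,m}^l(x,y)$ is the unique polynomial of the form $k\,x^ny^l+{}$(a linear combination of the monomials $x^iy^j$ with $0\le j\le m$ and either $0\le i<n$, or $i=n$ and $j<l$), with $k>0$, such that $\mathcal{F}(p_{n,m}^l x^iy^j)=0$ for all those lower monomials and $\mathcal{F}((p_{n,m}^l)^2)=1$. Put $\mathbb{P}_{n,m}=[p_{n,m}^0,\dots,p_{n,m}^m]^t$. Reverse lexicographic polynomials. For $0\le l\le n$, $\tilde p_{n,m}^l(x,y)$ is the unique polynomial of the form $\tilde k\,x^ly^m+{}$(a linear combination of the monomials $x^iy^j$ with $0\le i\le n$ and either $0\le j<m$, or $j=m$ and $i<l$), with $\tilde k>0$, such that $\mathcal{F}(\tilde p_{n,m}^l x^iy^j)=0$ for all those lower monomials and $\mathcal{F}((\tilde p_{n,m}^l)^2)=1$. Put $\tilde{\mathbb{P}}_{n,m}=[\tilde p_{n,m}^0,\dots,\tilde p_{n,m}^n]^t$. For vector polynomials $f,g$ put $\langle f,g\rangle=\mathcal{F}(fg^t)$ (applied entrywise). For $n,m\ge1$ define $$\mathcal{K}_{n,m}=\langle\mathbb{P}_{n,m-1},\tilde{\mathbb{P}}_{n-1,m}\rangle\ (m\times n),\quad J^1_{n,m}=\langle y\mathbb{P}_{n,m-1},\mathbb{P}_{n,m}\rangle\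 (m\times(m+1)),\quad J^2_{n,m}=-\langle y\mathbb{P}_{n,m-1},\tilde{\mathbb{P}}_{n-1,m}\rangle\ (m\times n).$$ Parameters of $\mathcal{F}$ (matrix entries are indexed starting from 1). For $n,m\ge 1$: $$s_{2n-1,2m-1}=(\mathcal{K}_{n,m})_{m,n},\quad s_{2n-1,2m}=(J^2_{n,m})_{m,n},\quad s_{2n,2m-1}=(J^1_{n,m})_{m,m},\quad s_{2n,2m}=(J^1_{n,m})_{m,m+1}.$$ On the coordinate lines, $s_{0,0}=\mathcal{F}(1)$ and the remaining parameters are the one-variable recurrence coefficients: $$x\,p_{n,0}^0=s_{2n+2,0}\,p_{n+1,0}^0+s_{2n+1,0}\,p_{n,0}^0+s_{2n,0}\,p_{n-1,0}^0,\qquad y\,\tilde p_{0,m}^0=s_{0,2m+2}\,\tilde p_{0,m+1}^0+s_{0,2m+1}\,\tilde p_{0,m}^0+s_{0,2m}\,\tilde p_{0,m-1}^0,$$ for $n,m\ge 0$, with $p^0_{-1,0}=\tilde p^0_{0,-1}=0$. Known fact (Delgado, Geronimo, Iliev, Marcellán): an array $(s_{i,j})$ is the parameter array of at most one such $\mathcal{F}$; it is one exactly when $s_{2i,2j}>0$ for all $i,j$ and the matrices $\mathcal{K}_{i,j}$, which are computed recursively from the parameters, satisfy $\|\mathcal{K}_{i,j}\|<1$ for all $i,j\ge 1$. "The polynomials constructed with the parameters $(s_{i,j})$" are the $\mathbb{P}_{n,m}$ of this functional. *)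

theory Defs
  imports "HOL-Analysis.Analysis" "Jordan_Normal_Form.Matrix"
begin

unbundle no vec_syntax
hide_type (open) Finite_Cartesian_Product.vec
hide_const (open) Finite_Cartesian_Product.vec

text \<open>
  A polynomial in \<open>\<real>[x,y]\<close> is a value of type \<open>real poly poly\<close>: the outer indeterminate
  is \<open>x\<close>, the inner one is \<open>y\<close>.  So the coefficient of \<open>x^i y^j\<close> in \<open>p\<close> is
  \<open>coeff (coeff p i) j\<close>, and a real scalar \<open>c\<close> acts as \<open>smult [:c:]\<close>.
\<close>

type_synonym bipoly = "real poly poly"

definition varx :: bipoly where
  "varx = [:0, 1:]"

definition vary :: bipoly where
  "vary = [:[:0, 1:]:]"

definition scale :: "real \<Rightarrow> bipoly \<Rightarrow> bipoly" where
  "scale c p = Polynomial.smult [:c:] p"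

definition coeff2 :: "bipoly \<Rightarrow> nat \<Rightarrow> nat \<Rightarrow> real" where
  "coeff2 p i j = Polynomial.coeff (Polynomial.coeff p i) j"

definition eval2 :: "bipoly \<Rightarrow> real \<times> real \<Rightarrow> real" where
  "eval2 p z = poly (poly p [:fst z:]) (snd z)"

definition linear_functional :: "(bipoly \<Rightarrow> real) \<Rightarrow> bool" where
  "linear_functional F \<longleftrightarrow>
     (\<forall>p q. F (p + q) = F p + F q) \<and> (\<forall>c p. F (scale c p) = c * F p)"

definition positive_definite :: "(bipoly \<Rightarrow> real) \<Rightarrow> bool" where
  "positive_definite F \<longleftrightarrow> linear_functional F \<and> (\<forall>f. f \<noteq> 0 \<longrightarrow> F (f\<^sup>2) > 0)"

text \<open>
  Exponents \<open>(i,j)\<close> of the monomials preceding \<open>x^n y^l\<close> (lexicographic order, degree in \<open>y\<close> at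
  most \<open>m\<close>), respectively preceding \<open>x^l y^m\<close> (reverse lexicographic order, degree in \<open>x\<close> at
  most \<open>n\<close>).
\<close>

definition lex_below :: "nat \<Rightarrow> nat \<Rightarrow> nat \<Rightarrow> (nat \<times> nat) set" where
  "lex_below n m l = {(i, j). j \<le> m \<and> (i < n \<or> i = n \<and> j < l)}"

definition revlex_below :: "nat \<Rightarrow> nat \<Rightarrow> nat \<Rightarrow> (nat \<times> nat) set" where
  "revlex_below n m l = {(i, j). i \<le> n \<and> (j < m \<or> j = m \<and> i < l)}"

text \<open>
  \<open>p\<close> is a positive multiple of \<open>x^a y^b\<close> plus a linear combination of the monomials with
  exponents in \<open>B\<close>, is orthogonal to those monomials, and has norm one.
\<close>

definition is_orthonormal_poly ::
    "(bipoly \<Rightarrow> real) \<Rightarrow> nat \<times> nat \<Rightarrow> (nat \<times> nat) set \<Rightarrow> bipoly \<Rightarrow> bool" where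
  "is_orthonormal_poly F ab B p \<longleftrightarrow>
     coeff2 p (fst ab) (snd ab) > 0 \<and>
     (\<forall>i j. coeff2 p i j \<noteq> 0 \<longrightarrow> (i, j) \<in> insert ab B) \<and>
     (\<forall>(i, j) \<in> B. F (p * varx ^ i * vary ^ j) = 0) \<and>
     F (p\<^sup>2) = 1"

text \<open>
  For positive definite \<open>F\<close> and \<open>l \<le> m\<close> (respectively \<open>l \<le> n\<close>) the following descriptions
  have exactly one solution.
\<close>

definition lex_poly :: "(bipoly \<Rightarrow> real) \<Rightarrow> nat \<Rightarrow> nat \<Rightarrow> nat \<Rightarrow> bipoly" where
  "lex_poly F n m l = (THE p. is_orthonormal_poly F (n, l) (lex_below n m l) p)"

definition revlex_poly :: "(bipoly \<Rightarrow> real) \<Rightarrow> nat \<Rightarrow> nat \<Rightarrow> nat \<Rightarrow> bipoly" where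
  "revlex_poly F n m l = (THE p. is_orthonormal_poly F (l, m) (revlex_below n m l) p)"

definition lex_vec :: "(bipoly \<Rightarrow> real) \<Rightarrow> nat \<Rightarrow> nat \<Rightarrow> bipoly vec" where
  "lex_vec F n m = vec (m + 1) (\<lambda>l. lex_poly F n m l)"

definition revlex_vec :: "(bipoly \<Rightarrow> real) \<Rightarrow> nat \<Rightarrow> nat \<Rightarrow> bipoly vec" where
  "revlex_vec F n m = vec (n + 1) (\<lambda>l. revlex_poly F n m l)"

text \<open>The matrix \<open>\<langle>f, g\<rangle>\<close> obtained by applying \<open>F\<close> to every entry of \<open>f g^t\<close>.\<close>

definition gram :: "(bipoly \<Rightarrow> real) \<Rightarrow> bipoly vec \<Rightarrow> bipoly vec \<Rightarrow> real mat" where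
  "gram F f g = mat (dim_vec f) (dim_vec g) (\<lambda>(i, j). F (f $ i * g $ j))"

text \<open>The matrices \<open>K\<close>, \<open>J1\<close>, \<open>J2\<close> are meant for \<open>n, m \<ge> 1\<close> only.\<close>

definition K_mat :: "(bipoly \<Rightarrow> real) \<Rightarrow> nat \<Rightarrow> nat \<Rightarrow> real mat" where
  "K_mat F n m = gram F (lex_vec F n (m - 1)) (revlex_vec F (n - 1) m)"

definition J1_mat :: "(bipoly \<Rightarrow> real) \<Rightarrow> nat \<Rightarrow> nat \<Rightarrow> real mat" where
  "J1_mat F n m = gram F (vary \<cdot>\<^sub>v lex_vec F n (m - 1)) (lex_vec F n m)"

definition J2_mat :: "(bipoly \<Rightarrow> real) \<Rightarrow> nat \<Rightarrow> nat \<Rightarrow> real mat" where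
  "J2_mat F n m = - gram F (vary \<cdot>\<^sub>v lex_vec F n (m - 1)) (revlex_vec F (n - 1) m)"

text \<open>
  The array \<open>s\<close> consists of the parameters of \<open>F\<close>.  Matrix indices in the library start at 0,
  so the entry written \<open>(a, b)\<close> with indices starting at 1 is \<open>(a - 1, b - 1)\<close> here.
\<close>

definition is_parameter_array :: "(bipoly \<Rightarrow> real) \<Rightarrow> (nat \<Rightarrow> nat \<Rightarrow> real) \<Rightarrow> bool" where
  "is_parameter_array F s \<longleftrightarrow>
     (\<forall>n \<ge> 1. \<forall>m \<ge> 1.
        s (2*n - 1) (2*m - 1) = K_mat F n m $$ (m - 1, n - 1) \<and>
        s (2*n - 1) (2*m) = J2_mat F n m $$ (m - 1, n - 1) \<and>
        s (2*n) (2*m - 1) = J1_mat F n m $$ (m - 1, m - 1) \<and>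
        s (2*n) (2*m) = J1_mat F n m $$ (m - 1, m)) \<and>
     s 0 0 = F 1 \<and>
     (\<forall>n. varx * lex_poly F n 0 0 =
        scale (s (2*n + 2) 0) (lex_poly F (n + 1) 0 0) +
        scale (s (2*n + 1) 0) (lex_poly F n 0 0) +
        (if n = 0 then 0 else scale (s (2*n) 0) (lex_poly F (n - 1) 0 0))) \<and>
     (\<forall>m. vary * revlex_poly F 0 m 0 =
        scale (s 0 (2*m + 2)) (revlex_poly F 0 (m + 1) 0) +
        scale (s 0 (2*m + 1)) (revlex_poly F 0 m 0) +
        (if m = 0 then 0 else scale (s 0 (2*m)) (revlex_poly F 0 (m - 1) 0)))"

definition weight :: "real \<Rightarrow> real \<times> real \<Rightarrow> real" where
  "weight a = (\<lambda>(x, y).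
     4 / pi\<^sup>2 *
     ((1 - a\<^sup>2) * sqrt (1 - x\<^sup>2) * sqrt (1 - y\<^sup>2) /
      (4 * a\<^sup>2 * (x\<^sup>2 + y\<^sup>2) - 4 * a * (1 + a\<^sup>2) * x * y + (1 - a\<^sup>2)\<^sup>2)))"

text \<open>The measure with the above density on the square \<open>[-1,1]^2\<close>, extended by zero to the plane.\<close>

definition mu :: "real \<Rightarrow> (real \<times> real) measure" where
  "mu a = density lborel
     (\<lambda>z. ennreal (weight a z * indicator ({-1..1} \<times> {-1..1}) z))"

end

theory Submission
  imports Defs
begin

text \<open>
  Write \<open>a = s 1 1\<close> and let \<open>U\<^sub>n\<close> be the Chebyshev polynomials of the second kind.
  The density of \<open>mu a\<close> is the product of two semicircle densities with the Poisson kernel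
  \<open>\<Sum>k. a\<^sup>k U\<^sub>k(x) U\<^sub>k(y)\<close>, so the functional \<open>F\<close> of integration against \<open>mu a\<close> satisfies
  \<open>F (U\<^sub>n(x) h(y)) = a\<^sup>n F (U\<^sub>n(y) h(y))\<close>.  From this and the three-term recurrence one reads off
  its orthonormal polynomials: \<open>U\<^sub>n(x) U\<^sub>m(y) - a U\<^sub>n\<^sub>-\<^sub>1(x) U\<^sub>m\<^sub>-\<^sub>1(y)\<close> at the corner \<open>(n, m)\<close>, and
  for \<open>n \<ge> 1\<close>, \<open>l < m\<close>, up to normalization,
  \<open>(U\<^sub>n(x) - 2 a y U\<^sub>n\<^sub>-\<^sub>1(x) + a\<^sup>2 U\<^sub>n\<^sub>-\<^sub>2(x)) U\<^sub>l(y)\<close> (with \<open>U\<^sub>-\<^sub>1 = 0\<close>); hence its parameters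
  are the given ones.

  Conversely, if the moments of a functional with these parameters agree with those of \<open>F\<close> up to
  bidegrees \<open>(2n, 2m - 2)\<close> and \<open>(2n - 2, 2m)\<close>, then the four parameters at \<open>(n, m)\<close> determine
  the four new moments up to \<open>(2n, 2m)\<close> one after the other.
\<close>

section \<open>Chebyshev polynomials\<close>

text \<open>Index shift: \<open>cheb (Suc n)\<close> is \<open>U\<^sub>n\<close>, and \<open>cheb 0\<close> is \<open>U\<^sub>-\<^sub>1 = 0\<close>.\<close>

fun cheb :: "nat \<Rightarrow> 'a::comm_ring_1 \<Rightarrow> 'a" where
  "cheb 0 z = 0"
| "cheb (Suc 0) z = 1"
| "cheb (Suc (Suc n)) z = 2 * z * cheb (Suc n) z - cheb n z"

text \<open>The addition law of the \<open>U\<^sub>n\<close>, by induction along the three-term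
  recurrence. It collapses a corner polynomial to a single \<open>U\<^sub>k\<close> once
  \<open>x\<close> has been replaced by \<open>y\<close>.\<close>

lemma cheb_add: "cheb (Suc n) z * cheb (Suc m) z - cheb n z * cheb m z = cheb (Suc (n + m)) z"
proof (induction n z arbitrary: m rule: cheb.induct)
  case (3 n z)
  have "cheb (Suc (Suc (Suc n))) z * cheb (Suc m) z - cheb (Suc (Suc n)) z * cheb m z =
    2 * z * (cheb (Suc (Suc n)) z * cheb (Suc m) z - cheb (Suc n) z * cheb m z)
    - (cheb (Suc n) z * cheb (Suc m) z - cheb n z * cheb m z)"
    by (simp add: algebra_simps)
  also have "\<dots> = 2 * z * cheb (Suc (Suc (n + m))) z - cheb (Suc (n + m)) z"
    using 3[of m] by simp
  finally show ?case by simp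
qed auto

section \<open>Linear functionals and orthonormal polynomials\<close>

text \<open>Scalars as elements of the polynomial ring: with \<open>scale\<close> rewritten to a
  product by \<open>cst c\<close>, identities involving scalars become ring identities for
  \<open>algebra_simps\<close>.\<close>

definition cst :: "real \<Rightarrow> bipoly" where
  "cst c = [:[:c:]:]"

lemma scale_cst: "scale c p = cst c * p"
  by (simp add: scale_def cst_def)

lemma cst_hom [simp]: "cst 0 = 0" "cst 1 = 1" "cst (c + d) = cst c + cst d"
    "cst (c - d) = cst c - cst d" "cst (- c) = - cst c" "cst (c * d) = cst c * cst d"
    "cst (numeral k) = numeral k" "cst (c ^ n) = cst c ^ n"
proof -
  show "cst 0 = 0" "cst 1 = 1" "cst (c + d) = cst c + cst d"
    "cst (c - d) = cst c - cst d" "cst (- c) = - cst c" and m: "\<And>c d. cst (c * d) = cst c * cst d"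
    by (simp_all add: cst_def one_pCons)
  show "cst (numeral k) = numeral k" by (simp add: cst_def numeral_poly)
  show "cst (c ^ n) = cst c ^ n" by (induction n) (simp_all add: m, simp add: cst_def one_pCons)
qed

lemma scale_mult: "scale c p * q = scale c (p * q)" "p * scale c q = scale c (p * q)"
  by (simp_all add: scale_cst)

lemma scale_one [simp]: "scale 1 p = p" and scale_zero [simp]: "scale 0 p = 0" "scale c 0 = 0"
  and scale_scale [simp]: "scale c (scale d p) = scale (c * d) p"
  by (simp_all add: scale_cst mult.assoc)

context
  fixes F assumes lin: "linear_functional F"
begin

lemma lf_add: "F (p + q) = F p + F q"
  and lf_scale: "F (scale c p) = c * F p"
  using lin by (auto simp: linear_functional_def)

lemma lf_zero: "F 0 = 0"
  using lf_add[of 0 0] by simp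

lemma lf_minus: "F (- p) = - F p"
  using lf_add[of p "- p"] lf_zero by simp

lemma lf_diff: "F (p - q) = F p - F q"
  using lf_add[of p "- q"] lf_minus[of q] by simp

lemma lf_sum: "F (sum f A) = (\<Sum>i\<in>A. F (f i))"
  by (induction A rule: infinite_finite_induct) (auto simp: lf_add lf_zero)

lemma linear_functional_times: "linear_functional (\<lambda>p. F (q * p))"
  unfolding linear_functional_def by (simp add: distrib_left scale_mult lf_add lf_scale)

end

section \<open>Coefficients, supports, and functionals compared on monomials\<close>

definition supported :: "(nat \<times> nat) set \<Rightarrow> bipoly \<Rightarrow> bool" where
  "supported B p \<longleftrightarrow> (\<forall>i j. coeff2 p i j \<noteq> 0 \<longrightarrow> (i, j) \<in> B)"

lemma coeff2_simps [simp]: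
  "coeff2 0 i j = 0"
  "coeff2 (p + q) i j = coeff2 p i j + coeff2 q i j"
  "coeff2 (p - q) i j = coeff2 p i j - coeff2 q i j"
  "coeff2 (scale c p) i j = c * coeff2 p i j"
  by (simp_all add: coeff2_def scale_def)

lemma coeff2_mult:
  "coeff2 (p * q) i j = (\<Sum>k\<le>i. \<Sum>l\<le>j. coeff2 p k l * coeff2 q (i - k) (j - l))"
  by (simp add: coeff2_def coeff_mult coeff_sum)

lemma bipoly_eqI: "(\<And>i j. coeff2 p i j = coeff2 q i j) \<Longrightarrow> p = q"
  by (simp add: coeff2_def poly_eq_iff)

lemma vary_power: "vary ^ j = [:[:0, 1:] ^ j:]"
  by (induction j) (simp_all add: vary_def one_pCons)

lemma varx_power: "varx ^ i = monom 1 i"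
  by (simp add: varx_def monom_altdef)

lemma coeff2_monom: "coeff2 (varx ^ i * vary ^ j) k l = (if k = i \<and> l = j then 1 else 0)"
proof -
  have "[:0, 1:] ^ j = monom (1::real) j" by (simp add: monom_altdef)
  thus ?thesis by (simp add: coeff2_def varx_power vary_power mult.commute[of "monom _ _"] smult_monom)
qed

lemma bipoly_expand:
  "p = (\<Sum>i\<le>degree p. \<Sum>j\<le>degree (coeff p i). scale (coeff2 p i j) (varx ^ i * vary ^ j))"
    (is "p = ?s")
proof (rule bipoly_eqI)
  fix k l
  have c2s: "coeff2 (sum f A) k l = (\<Sum>i\<in>A. coeff2 (f i) k l)" for A :: "nat set" and f
    by (induction A rule: infinite_finite_induct) auto
  have "coeff2 ?s k l = (\<Sum>i\<le>degree p. \<Sum>j\<le>degree (coeff p i). if k = i \<and> l = j then coeff2 p i j else 0)"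
    by (simp add: c2s coeff2_monom if_distrib cong: if_cong)
  also have "\<dots> = (\<Sum>i\<le>degree p. if k = i then \<Sum>j\<le>degree (coeff p i). if l = j then coeff2 p i j else 0 else 0)"
    by (intro sum.cong) auto
  also have "\<dots> = coeff2 p k l"
    by (auto simp: coeff2_def coeff_eq_0)
  finally show "coeff2 p k l = coeff2 ?s k l" ..
qed

lemma linear_functional_eq_on:
  assumes "linear_functional G" "linear_functional H" "supported B p"
    and "\<And>i j. (i, j) \<in> B \<Longrightarrow> G (varx ^ i * vary ^ j) = H (varx ^ i * vary ^ j)"
  shows "G p = H p"
proof -
  have "coeff2 p i j * G (varx ^ i * vary ^ j) = coeff2 p i j * H (varx ^ i * vary ^ j)" for i j
    using assms(3,4) by (auto simp: supported_def)
  thus ?thesis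
    by (subst (1 2) bipoly_expand)
       (simp only: lf_sum[OF assms(1)] lf_sum[OF assms(2)] lf_scale[OF assms(1)] lf_scale[OF assms(2)])
qed

lemma linear_functional_zero: "linear_functional (\<lambda>_. 0)"
  by (simp add: linear_functional_def)

lemma orthogonal_supported:
  assumes F: "linear_functional F" and "\<And>i j. (i, j) \<in> B \<Longrightarrow> F (p * varx ^ i * vary ^ j) = 0"
    and "supported B q"
  shows "F (p * q) = 0"
  using linear_functional_eq_on[OF linear_functional_times[OF F, of p] linear_functional_zero assms(3)] assms(2)
  by (simp add: mult.assoc)

text \<open>Removing the leading term of \<open>p\<close> leaves a polynomial on which
  \<open>G\<close> and \<open>H\<close> agree; dividing by the nonzero leading coefficient gives the
  remaining moment. This is how one scalar equation fixes one new moment.\<close>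

lemma linear_functional_extend:
  assumes GH: "linear_functional G" "linear_functional H"
    and "\<And>i j. (i, j) \<in> B \<Longrightarrow> G (varx ^ i * vary ^ j) = H (varx ^ i * vary ^ j)"
    and "supported (insert (a, b) B) p" "coeff2 p a b \<noteq> 0" "G p = H p"
  shows "G (varx ^ a * vary ^ b) = H (varx ^ a * vary ^ b)"
proof -
  let ?r = "p - scale (coeff2 p a b) (varx ^ a * vary ^ b)"
  have "supported B ?r"
    using assms(4) by (auto simp: supported_def coeff2_monom split: if_splits)
  hence "G ?r = H ?r" using assms(3) by (rule linear_functional_eq_on[OF GH])
  thus ?thesis using assms
    by (simp add: lf_diff[OF GH(1)] lf_diff[OF GH(2)] lf_scale[OF GH(1)] lf_scale[OF GH(2)])
qed

lemma supported_mono: "supported A p \<Longrightarrow> A \<subseteq> B \<Longrightarrow> supported B p"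
  by (auto simp: supported_def)

lemma supported_arith:
  "supported B p \<Longrightarrow> supported B q \<Longrightarrow> supported B (p + q)"
  "supported B p \<Longrightarrow> supported B q \<Longrightarrow> supported B (p - q)"
  "supported B p \<Longrightarrow> supported B (scale c p)"
  "supported B 0"
  by (auto simp: supported_def) (metis add_0, metis diff_0_right)

lemma supported_monom: "(i, j) \<in> B \<Longrightarrow> supported B (varx ^ i * vary ^ j)"
  by (auto simp: supported_def coeff2_monom split: if_splits)

lemma supported_mult:
  assumes "supported A p" "supported B q"
    and "\<And>i j k l. (i, j) \<in> A \<Longrightarrow> (k, l) \<in> B \<Longrightarrow> (i + k, j + l) \<in> C"
  shows "supported C (p * q)"
  unfolding supported_def
proof (intro allI impI)
  fix i j assume "coeff2 (p * q) i j \<noteq> 0"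
  then obtain k l where "k \<le> i" "l \<le> j" "coeff2 p k l * coeff2 q (i - k) (j - l) \<noteq> 0"
    unfolding coeff2_mult by (meson sum.neutral atMost_iff)
  thus "(i, j) \<in> C"
    using assms(3)[of k l "i - k" "j - l"] assms(1,2) by (auto simp: supported_def)
qed

text \<open>The last hypothesis leaves a single nonzero term in the convolution sum for this
  coefficient.\<close>

lemma coeff2_mult_top:
  assumes "supported A p" "supported B q"
    and "\<And>k l. k \<le> i + i' \<Longrightarrow> l \<le> j + j' \<Longrightarrow> (k, l) \<in> A \<Longrightarrow> (i + i' - k, j + j' - l) \<in> B \<Longrightarrow> k = i \<and> l = j"
  shows "coeff2 (p * q) (i + i') (j + j') = coeff2 p i j * coeff2 q i' j'"
proof -
  have "coeff2 (p * q) (i + i') (j + j') = (\<Sum>k\<le>i+i'. \<Sum>l\<le>j+j'. if k = i \<and> l = j then coeff2 p i j * coeff2 q i' j' else 0)"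
    unfolding coeff2_mult using assms by (intro sum.cong refl) (fastforce simp: supported_def)
  also have "\<dots> = (\<Sum>k\<le>i+i'. if k = i then \<Sum>l\<le>j+j'. if l = j then coeff2 p i j * coeff2 q i' j' else 0 else 0)"
    by (intro sum.cong refl) auto
  also have "\<dots> = coeff2 p i j * coeff2 q i' j'" by simp
  finally show ?thesis .
qed

section \<open>Uniqueness, existence and normalization of orthonormal polynomials\<close>

lemma orthonormal_poly_supported:
  "is_orthonormal_poly F ab B p \<Longrightarrow> supported (insert ab B) p"
  by (auto simp: is_orthonormal_poly_def supported_def)

lemma orthonormal_poly_orthogonal:
  "linear_functional F \<Longrightarrow> is_orthonormal_poly F ab B p \<Longrightarrow> supported B q \<Longrightarrow> F (p * q) = 0"
  by (rule orthogonal_supported) (auto simp: is_orthonormal_poly_def)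

text \<open>The combination \<open>r\<close> of \<open>p\<close> and \<open>q\<close> that cancels
  the leading terms is supported in \<open>B\<close>, hence orthogonal to \<open>p\<close> and
  \<open>q\<close> and so to itself; definiteness gives \<open>r = 0\<close>. Equal norms and
  positive leading coefficients then make the ratio one.\<close>

lemma orthonormal_poly_unique:
  assumes F: "positive_definite F" and ab: "ab \<notin> B"
    and p: "is_orthonormal_poly F ab B p" and q: "is_orthonormal_poly F ab B q"
  shows "p = q"
proof -
  have lin: "linear_functional F" using F by (simp add: positive_definite_def)
  define c d where "c = coeff2 p (fst ab) (snd ab)" and "d = coeff2 q (fst ab) (snd ab)"
  have pos: "c > 0" "d > 0" using p q by (auto simp: c_def d_def is_orthonormal_poly_def)
  define r where "r = scale d p - scale c q"
  have "supported (insert ab B) r"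
    unfolding r_def using p q by (intro supported_arith orthonormal_poly_supported)
  moreover have "coeff2 r (fst ab) (snd ab) = 0"
    by (simp add: r_def c_def d_def)
  ultimately have "supported B r"
    by (cases ab) (auto simp: supported_def)
  hence "F (p * r) = 0" "F (q * r) = 0"
    using orthonormal_poly_orthogonal[OF lin] p q by blast+
  moreover have "r\<^sup>2 = scale d (p * r) - scale c (q * r)"
    by (simp add: power2_eq_square r_def scale_cst algebra_simps)
  ultimately have "F (r\<^sup>2) = 0"
    by (simp add: lf_diff[OF lin] lf_scale[OF lin])
  hence "r = 0" using F by (auto simp: positive_definite_def)
  hence "scale d p = scale c q" by (simp add: r_def)
  hence "scale (1/d) (scale d p) = scale (1/d) (scale c q)" by simp
  hence pq: "p = scale (c/d) q" using pos by simp
  have "p\<^sup>2 = scale ((c/d)\<^sup>2) (q\<^sup>2)"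
    unfolding pq power2_eq_square by (simp add: scale_mult)
  hence "F (p\<^sup>2) = (c/d)\<^sup>2 * F (q\<^sup>2)" by (simp add: lf_scale[OF lin])
  hence "(c/d)\<^sup>2 = 1" using p q by (simp add: is_orthonormal_poly_def)
  hence "c/d = 1" using pos by (simp add: power2_eq_1_iff) (smt (verit) divide_pos_pos)
  thus ?thesis using pq by simp
qed

text \<open>Gram-Schmidt, one monomial at a time. The polynomial \<open>f\<close> is kept arbitrary
  because the induction hypothesis is applied both to \<open>f\<close> and to the new monomial
  \<open>x\<close>.\<close>

lemma orthogonal_projection_exists:
  assumes F: "positive_definite F" and "finite B"
  shows "\<exists>g. supported B g \<and> (\<forall>(i, j)\<in>B. F ((f - g) * varx ^ i * vary ^ j) = 0)"
  using \<open>finite B\<close>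
proof (induction B arbitrary: f)
  case empty
  show ?case by (intro exI[of _ 0]) (auto simp: supported_def)
next
  case (insert b B)
  have lin: "linear_functional F" using F by (simp add: positive_definite_def)
  obtain a c where b: "b = (a, c)" by force
  define x where "x = varx ^ a * vary ^ c"
  obtain g h where g: "supported B g" "\<And>i j. (i, j)\<in>B \<Longrightarrow> F ((f - g) * varx ^ i * vary ^ j) = 0"
    and h: "supported B h" "\<And>i j. (i, j)\<in>B \<Longrightarrow> F ((x - h) * varx ^ i * vary ^ j) = 0"
    using insert.IH[of f] insert.IH[of x] by fast
  define e where "e = x - h"
  have "coeff2 e a c = 1"
    using h(1) insert.hyps b by (auto simp: e_def x_def coeff2_monom supported_def)
  hence "e \<noteq> 0" by auto
  hence ee: "F (e\<^sup>2) > 0" using F by (auto simp: positive_definite_def)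
  \<comment> \<open>The multiple of \<open>e\<close> that makes the new remainder orthogonal to
    \<open>x\<close>, since \<open>F (e * x) = F (e\<^sup>2)\<close>. Orthogonality to
    \<open>B\<close> survives because \<open>e\<close> is itself orthogonal to
    \<open>B\<close>.\<close>
  define t where "t = F ((f - g) * x) / F (e\<^sup>2)"
  have eh: "F (e * h) = 0"
    by (rule orthogonal_supported[OF lin _ h(1)]) (use h(2) e_def in auto)
  have ex: "F (e * x) = F (e\<^sup>2)"
    using eh by (simp add: e_def power2_eq_square right_diff_distrib lf_diff[OF lin])
  have "supported (insert b B) (g + scale t e)"
    unfolding e_def x_def b
    by (intro supported_arith supported_monom) (auto intro: supported_mono g h)
  moreover have "F ((f - (g + scale t e)) * varx ^ i * vary ^ j) = 0" if "(i, j) \<in> insert b B" for i j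
  proof (cases "(i, j) = b")
    case True
    have "(f - (g + scale t e)) * x = (f - g) * x - scale t (e * x)"
      by (simp add: scale_cst algebra_simps)
    hence "F ((f - (g + scale t e)) * x) = 0"
      using ee by (simp add: lf_diff[OF lin] lf_scale[OF lin] ex t_def)
    thus ?thesis using True b by (simp add: x_def mult.assoc)
  next
    case False
    hence *: "(i, j) \<in> B" using that by auto
    have "(f - (g + scale t e)) * varx ^ i * vary ^ j
       = (f - g) * varx ^ i * vary ^ j - scale t (e * varx ^ i * vary ^ j)"
      by (simp add: scale_cst algebra_simps)
    thus ?thesis using g(2)[OF *] h(2)[OF *] by (simp add: lf_diff[OF lin] lf_scale[OF lin] e_def)
  qed
  ultimately show ?case by blast
qed

lemma orthonormal_poly_normalize:
  assumes F: "positive_definite F" and ab: "coeff2 p (fst ab) (snd ab) > 0"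
    and "supported (insert ab B) p" "\<And>i j. (i, j) \<in> B \<Longrightarrow> F (p * varx ^ i * vary ^ j) = 0"
  shows "is_orthonormal_poly F ab B (scale (1 / sqrt (F (p\<^sup>2))) p)"
proof -
  have lin: "linear_functional F" using F by (simp add: positive_definite_def)
  have "p \<noteq> 0" using ab by auto
  hence pos: "F (p\<^sup>2) > 0" using F by (auto simp: positive_definite_def)
  have "(scale c p)\<^sup>2 = scale (c\<^sup>2) (p\<^sup>2)" for c
    by (simp add: power2_eq_square scale_mult)
  thus ?thesis
    using assms pos
    by (auto simp: is_orthonormal_poly_def supported_def scale_mult lf_scale[OF lin] power_divide)
qed

lemma orthonormal_poly_exists:
  assumes F: "positive_definite F" and ab: "ab \<notin> B" and "finite B"
  shows "\<exists>p. is_orthonormal_poly F ab B p"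
proof -
  define x where "x = varx ^ fst ab * vary ^ snd ab"
  obtain g where g: "supported B g" "\<And>i j. (i, j)\<in>B \<Longrightarrow> F ((x - g) * varx ^ i * vary ^ j) = 0"
    using orthogonal_projection_exists[OF F \<open>finite B\<close>, of x] by fast
  have "coeff2 (x - g) (fst ab) (snd ab) = 1"
    using g(1) ab by (cases ab) (auto simp: x_def coeff2_monom supported_def)
  moreover have "supported (insert ab B) (x - g)"
    unfolding x_def by (intro supported_arith supported_monom) (auto intro: supported_mono g)
  ultimately show ?thesis
    using orthonormal_poly_normalize[OF F, of "x - g" ab B] g(2) by auto
qed

lemma lex_poly_eqI:
  assumes "positive_definite F" "is_orthonormal_poly F (n, l) (lex_below n m l) p"
  shows "lex_poly F n m l = p"
  unfolding lex_poly_def using assms(2)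
  by (intro the_equality) (auto intro: orthonormal_poly_unique[OF assms(1) _ _ assms(2)] simp: lex_below_def)

lemma lex_poly_orthonormal:
  assumes F: "positive_definite F"
  shows "is_orthonormal_poly F (n, l) (lex_below n m l) (lex_poly F n m l)"
proof -
  have "finite (lex_below n m l)"
    by (rule finite_subset[of _ "{..n} \<times> {..m}"]) (auto simp: lex_below_def)
  then obtain p where "is_orthonormal_poly F (n, l) (lex_below n m l) p"
    using orthonormal_poly_exists[OF F, of "(n, l)" "lex_below n m l"] by (auto simp: lex_below_def)
  thus ?thesis using lex_poly_eqI[OF F] by simp
qed

text \<open>At the corner both orders precede it by the same set, the rectangle without
  \<open>(n, m)\<close>. All parameters involve only such corner entries of the reverse
  lexicographic vectors, so these vectors can be eliminated.\<close>

lemma revlex_corner: "revlex_poly F n m n = lex_poly F n m m"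
proof -
  have "revlex_below n m n = lex_below n m m"
    by (auto simp: revlex_below_def lex_below_def)
  thus ?thesis by (simp add: lex_poly_def revlex_poly_def)
qed

section \<open>The functional coupling two Chebyshev functionals\<close>

definition corner :: "real \<Rightarrow> nat \<Rightarrow> nat \<Rightarrow> bipoly" where
  "corner a n m = cheb (Suc n) varx * cheb (Suc m) vary - scale a (cheb n varx * cheb m vary)"

text \<open>
  For fixed \<open>y\<close> the weight is of Bernstein-Szego type in \<open>x\<close>; the following are its orthogonal
  polynomials of degree \<open>n + 1\<close>.
\<close>

definition bern :: "real \<Rightarrow> nat \<Rightarrow> bipoly" where
  "bern a n = cheb (Suc (Suc n)) varx - scale (2 * a) (vary * cheb (Suc n) varx) + scale (a\<^sup>2) (cheb n varx)"

lemma cst_half: "2 * cst (1/2) = 1"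
proof -
  have "2 * cst (1/2) = cst (2 * (1/2))" by (simp only: cst_hom)
  also have "\<dots> = 1" by simp
  finally show ?thesis .
qed

text \<open>Lets recurrences with factor \<open>1/2\<close> be checked after doubling, where they
  are plain ring identities.\<close>

lemma half_eq: "2 * p = q \<Longrightarrow> p = scale (1/2) q"
  using cst_half by (auto simp: scale_cst mult.assoc[symmetric] mult.commute)

lemma times_cheb: "z * cheb (Suc n) z = scale (1/2) (cheb (Suc (Suc n)) z + cheb n z)"
  by (rule half_eq) (simp add: mult.assoc)

lemma varx_corner: "varx * corner a (Suc n) m = scale (1/2) (corner a (Suc (Suc n)) m + corner a n m)"
  by (rule half_eq) (simp add: corner_def scale_cst algebra_simps)

lemma vary_corner: "vary * corner a n (Suc m) = scale (1/2) (corner a n (Suc (Suc m)) + corner a n m)"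
  by (rule half_eq) (simp add: corner_def scale_cst algebra_simps)

lemma varx_bern_Suc: "varx * bern a (Suc n) = scale (1/2) (bern a (Suc (Suc n)) + bern a n)"
  by (rule half_eq) (simp add: bern_def scale_cst algebra_simps)

text \<open>The recurrence ends with a constant instead of another \<open>bern\<close>; this
  constant is the source of the squared norm \<open>1 - a\<^sup>2\<close>.\<close>

lemma varx_bern_0: "varx * bern a 0 = scale (1/2) (bern a 1 + cst (1 - a\<^sup>2))"
  by (rule half_eq) (simp add: bern_def scale_cst algebra_simps)

text \<open>Ties the two families together: supports and leading coefficients pass from
  \<open>corner\<close> to \<open>bern\<close>, and read backwards it splits a corner polynomial
  into orthogonal parts.\<close>

lemma bern_corner: "bern a n * cheb (Suc l) vary = corner a (Suc n) l - scale a (corner a n (Suc l))"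
  by (simp add: bern_def corner_def scale_cst algebra_simps power2_eq_square)

section \<open>Degrees, supports and leading coefficients\<close>

lemma cheb_vary: "cheb k vary = [:cheb k [:0, 1:]:]"
  by (induction k "vary" rule: cheb.induct)
     (simp_all add: one_pCons vary_def numeral_poly mult.commute)

lemma degree_vary: "degree vary = 0" "degree (cheb k vary) = 0" "degree (vary ^ j) = 0"
  by (simp_all add: vary_def cheb_vary[unfolded vary_def] vary_power[unfolded vary_def])

lemma degree_mult_0: "degree p = 0 \<Longrightarrow> degree q = 0 \<Longrightarrow> degree (p * q :: bipoly) = 0"
  using degree_mult_le[of p q] by simp

lemma coeff2_unsupported: "supported B p \<Longrightarrow> (i, j) \<notin> B \<Longrightarrow> coeff2 p i j = 0"
  by (auto simp: supported_def)

text \<open>Because of the index shift, \<open>cheb n\<close> has degree \<open>n - 1\<close> and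
  leading coefficient \<open>2 ^ (n - 1)\<close>, which explains the strict ranges and the exponent
  \<open>n + m - 2\<close>.\<close>

lemma supported_cheb:
  assumes "0 < n" "0 < m"
  shows "supported ({..<n} \<times> {..<m}) (cheb n varx * cheb m vary)"
    and "coeff2 (cheb n varx * cheb m vary) (n - 1) (m - 1) = 2 ^ (n + m - 2)"
proof -
  have x1: "supported {(1, 0)} varx" and y1: "supported {(0, 1)} vary"
    using supported_monom[of 1 0 "{(1, 0)}"] supported_monom[of 0 1 "{(0, 1)}"] by simp_all
  have one: "supported {(0, 0)} 1" using supported_monom[of 0 0 "{(0, 0)}"] by simp
  have two: "(2::bipoly) * p = scale 2 p" for p by (simp add: scale_cst)
  have x: "supported ({..<n} \<times> {0}) (cheb n varx)" for n
  proof (induction n "varx" rule: cheb.induct)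
    case (3 n)
    show ?case unfolding cheb.simps two scale_mult
      by (intro supported_arith supported_mult[OF x1 3(1)] supported_mono[OF 3(2)]) auto
  qed (use one in \<open>auto simp: supported_def\<close>)
  have y: "supported ({0} \<times> {..<n}) (cheb n vary)" for n
  proof (induction n "vary" rule: cheb.induct)
    case (3 n)
    show ?case unfolding cheb.simps two scale_mult
      by (intro supported_arith supported_mult[OF y1 3(1)] supported_mono[OF 3(2)]) auto
  qed (use one in \<open>auto simp: supported_def\<close>)
  show "supported ({..<n} \<times> {..<m}) (cheb n varx * cheb m vary)"
    by (rule supported_mult[OF x y]) auto
  have c1: "coeff2 (1::bipoly) 0 0 = 1" by (simp add: coeff2_def)
  have cx: "coeff2 (cheb (Suc n) varx) n 0 = 2 ^ n" for n
  proof (induction n "varx" rule: cheb.induct)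
    case (3 n)
    have "coeff2 (varx * cheb (Suc (Suc n)) varx) (1 + Suc n) (0 + 0) = coeff2 varx 1 0 * 2 ^ Suc n"
      using 3(1) by (subst coeff2_mult_top[OF x1 x]) auto
    moreover have "coeff2 (cheb (Suc n) varx) (Suc (Suc n)) 0 = 0"
      using x[of "Suc n"] by (rule coeff2_unsupported) simp
    moreover have "coeff2 varx 1 0 = 1" using coeff2_monom[of 1 0 1 0] by simp
    ultimately show ?case by (subst cheb.simps(3)) (simp add: two scale_mult del: cheb.simps)
  qed (auto simp: c1 two, use coeff2_monom[of 1 0 1 0] in simp)
  have cy: "coeff2 (cheb (Suc n) vary) 0 n = 2 ^ n" for n
  proof (induction n "vary" rule: cheb.induct)
    case (3 n)
    have "coeff2 (vary * cheb (Suc (Suc n)) vary) (0 + 0) (1 + Suc n) = coeff2 vary 0 1 * 2 ^ Suc n"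
      using 3(1) by (subst coeff2_mult_top[OF y1 y]) auto
    moreover have "coeff2 (cheb (Suc n) vary) 0 (Suc (Suc n)) = 0"
      using y[of "Suc n"] by (rule coeff2_unsupported) simp
    moreover have "coeff2 vary 0 1 = 1" using coeff2_monom[of 0 1 0 1] by simp
    ultimately show ?case by (subst cheb.simps(3)) (simp add: two scale_mult del: cheb.simps)
  qed (auto simp: c1 two, use coeff2_monom[of 0 1 0 1] in simp)
  obtain n' m' where nm: "n = Suc n'" "m = Suc m'" using assms by (metis gr0_implies_Suc)
  have "coeff2 (cheb n varx * cheb m vary) (n' + 0) (0 + m') = 2 ^ n' * 2 ^ m'"
    unfolding cx[of n', symmetric] cy[of m', symmetric] nm
    by (rule coeff2_mult_top[OF x y]) auto
  thus "coeff2 (cheb n varx * cheb m vary) (n - 1) (m - 1) = 2 ^ (n + m - 2)"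
    by (simp add: nm power_add)
qed

lemma supported_corner: "supported ({..n} \<times> {..m}) (corner a n m)"
  and coeff2_corner: "coeff2 (corner a n m) n m = 2 ^ (n + m)"
proof -
  have 1: "supported ({..<n} \<times> {..<m}) (cheb n varx * cheb m vary)"
    using supported_cheb(1)[of n m] by (cases "n = 0 \<or> m = 0") (auto simp: supported_def)
  show "supported ({..n} \<times> {..m}) (corner a n m)"
    unfolding corner_def
    by (intro supported_arith supported_mono[OF 1] supported_mono[OF supported_cheb(1)]) auto
  show "coeff2 (corner a n m) n m = 2 ^ (n + m)"
    using 1 supported_cheb(2)[of "Suc n" "Suc m"] by (auto simp: corner_def supported_def)
qed

text \<open>The summand with \<open>vary\<close> in \<open>bern\<close> reaches degree
  \<open>Suc l\<close> in \<open>y\<close>, but only at \<open>x\<close>-degrees up to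
  \<open>n\<close>; at the top \<open>x\<close>-degree the \<open>y\<close>-degree stays at most
  \<open>l\<close>.\<close>

lemma supported_bern: "supported ({..n} \<times> {..Suc l} \<union> {Suc n} \<times> {..l}) (bern a n * cheb (Suc l) vary)"
  and coeff2_bern: "coeff2 (bern a n * cheb (Suc l) vary) (Suc n) l = 2 ^ (Suc n + l)"
proof -
  show "supported ({..n} \<times> {..Suc l} \<union> {Suc n} \<times> {..l}) (bern a n * cheb (Suc l) vary)"
    unfolding bern_corner
    by (intro supported_arith supported_mono[OF supported_corner]) auto
  show "coeff2 (bern a n * cheb (Suc l) vary) (Suc n) l = 2 ^ (Suc n + l)"
    using coeff2_unsupported[OF supported_corner, of "Suc n" l n "Suc l" a]
    by (simp add: bern_corner coeff2_corner)
qed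

text \<open>For \<open>l = m\<close> the product with \<open>bern\<close> would exceed degree
  \<open>m\<close> in \<open>y\<close>, so the corner polynomial takes its place; for
  \<open>n = 0\<close> the polynomial \<open>corner a 0 l\<close> is just
  \<open>U\<^sub>l(y)\<close>.\<close>

definition lexP :: "real \<Rightarrow> nat \<Rightarrow> nat \<Rightarrow> nat \<Rightarrow> bipoly" where
  "lexP a n m l = (if n = 0 \<or> l = m then corner a n l
     else scale (1 / sqrt (1 - a\<^sup>2)) (bern a (n - 1) * cheb (Suc l) vary))"

text \<open>Orthogonality to \<open>B\<close> strips \<open>q\<close> down to its leading term, so
  norms and pairings reduce to one moment of \<open>p\<close>.\<close>

lemma orthogonal_leading:
  assumes F: "linear_functional F" and "supported (insert (n, l) B) q"
    and orth: "\<And>i j. (i, j) \<in> B \<Longrightarrow> F (p * varx ^ i * vary ^ j) = 0"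
  shows "F (p * q) = coeff2 q n l * F (p * varx ^ n * vary ^ l)"
proof (cases "(n, l) \<in> B")
  case True
  hence "F (p * q) = 0"
    using orthogonal_supported[OF F orth, of B q] assms by (simp add: insert_absorb)
  thus ?thesis using True orth by simp
next
  case False
  define r where "r = q - scale (coeff2 q n l) (varx ^ n * vary ^ l)"
  have "supported B r"
    using assms(2) by (auto simp: r_def supported_def coeff2_monom split: if_splits)
  hence "F (p * r) = 0" using orthogonal_supported[OF F orth] by blast
  thus ?thesis
    by (simp add: r_def right_diff_distrib scale_mult lf_diff[OF F] lf_scale[OF F] mult.assoc)
qed

text \<open>All that is used of the measure. Since \<open>x\<close> is the outer indeterminate,
  \<open>degree h = 0\<close> means that \<open>h\<close> depends on \<open>y\<close> only;
  \<open>F_cheb\<close> describes the semicircle law as the marginal in \<open>y\<close>.\<close>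

locale coupled_chebyshev =
  fixes F :: "bipoly \<Rightarrow> real" and a :: real
  assumes pd: "positive_definite F"
    and a: "\<bar>a\<bar> < 1"
    and transfer: "\<And>n h. degree h = 0 \<Longrightarrow> F (cheb (Suc n) varx * h) = a ^ n * F (cheb (Suc n) vary * h)"
    and F_cheb: "\<And>n. F (cheb (Suc n) vary) = (if n = 0 then 1 else 0)"
begin

section \<open>Moments and orthonormal polynomials of the coupled functional\<close>

lemma lin: "linear_functional F"
  using pd by (simp add: positive_definite_def)

lemmas F_simps = lf_add[OF lin] lf_diff[OF lin] lf_scale[OF lin] lf_zero[OF lin]

lemma a2: "1 - a\<^sup>2 > 0"
  using a by (simp add: abs_square_less_1)

text \<open>Each factor \<open>vary\<close> is absorbed by the recurrence. Only the path that lowers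
  the index at every step ends at \<open>U\<^sub>0\<close>, and it collects one factor
  \<open>1/2\<close> per step.\<close>

lemma cheb_moment:
  "j \<le> n \<Longrightarrow> F (cheb (Suc n) vary * vary ^ j) = (if j = n then (1/2) ^ n else 0)"
proof (induction j arbitrary: n)
  case 0
  thus ?case using F_cheb by simp
next
  case (Suc j)
  then obtain k where n: "n = Suc k" by (cases n) auto
  have "cheb (Suc n) vary * vary ^ Suc j = vary * cheb (Suc n) vary * vary ^ j" by simp
  also have "\<dots> = scale (1/2) (cheb (Suc (Suc n)) vary * vary ^ j + cheb (Suc k) vary * vary ^ j)"
    unfolding n times_cheb by (simp add: scale_mult algebra_simps)
  finally show ?case using Suc.IH[of "Suc n"] Suc.IH[of k] Suc.prems n by (simp add: F_simps)
qed

text \<open>The explicit \<open>a\<close> in \<open>corner\<close> compensates for the lower index,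
  so \<open>transfer\<close> gives both products the same factor \<open>a ^ n\<close>, and
  \<open>cheb_add\<close> applies.\<close>

lemma corner_const: "degree h = 0 \<Longrightarrow> F (corner a n m * h) = a ^ n * F (cheb (Suc (n + m)) vary * h)"
proof -
  assume h: "degree h = 0"
  have tr: "F (cheb (Suc k) varx * (cheb l vary * h)) = a ^ k * F (cheb (Suc k) vary * (cheb l vary * h))"
    for k l
    by (intro transfer degree_mult_0 degree_vary h)
  \<comment> \<open>For \<open>n = 0\<close> both sides vanish, as \<open>cheb 0\<close> is
    zero.\<close>
  have tr': "a * F (cheb n varx * (cheb l vary * h)) = a ^ n * F (cheb n vary * (cheb l vary * h))" for l
    by (cases n) (simp_all add: tr F_simps del: cheb.simps(3))
  have "F (corner a n m * h) = F (cheb (Suc n) varx * (cheb (Suc m) vary * h))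
       - a * F (cheb n varx * (cheb m vary * h))"
    by (simp only: corner_def left_diff_distrib scale_mult F_simps mult.assoc)
  also have "\<dots> = a ^ n * F (cheb (Suc n) vary * (cheb (Suc m) vary * h))
       - a ^ n * F (cheb n vary * (cheb m vary * h))"
    by (simp only: tr tr')
  also have "\<dots> = a ^ n * F ((cheb (Suc n) vary * cheb (Suc m) vary - cheb n vary * cheb m vary) * h)"
    by (simp only: left_diff_distrib right_diff_distrib F_simps mult.assoc)
  finally show ?thesis unfolding cheb_add .
qed

text \<open>Powers of \<open>x\<close> are absorbed by \<open>varx_corner\<close>. At
  \<open>i = 0\<close> the moment in \<open>y\<close> is nonzero for \<open>j \<le> m\<close> only
  if \<open>n = 0\<close> and \<open>j = m\<close>, where the factor \<open>a ^ n\<close> is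
  one.\<close>

lemma corner_moment:
  "i \<le> n \<Longrightarrow> j \<le> m \<Longrightarrow>
    F (corner a n m * varx ^ i * vary ^ j) = (if i = n \<and> j = m then (1/2) ^ (n + m) else 0)"
proof (induction i arbitrary: n)
  case 0
  have "F (corner a n m * varx ^ 0 * vary ^ j) = a ^ n * F (cheb (Suc (n + m)) vary * vary ^ j)"
    using corner_const[OF degree_vary(3)] by simp
  thus ?case using cheb_moment[of j "n + m"] 0 by auto
next
  case (Suc i)
  then obtain k where n: "n = Suc k" by (cases n) auto
  have "corner a n m * varx ^ Suc i * vary ^ j = (varx * corner a n m) * varx ^ i * vary ^ j"
    by (simp add: mult_ac)
  also have "\<dots> = scale (1/2) (corner a (Suc n) m * varx ^ i * vary ^ j + corner a k m * varx ^ i * vary ^ j)"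
    unfolding n varx_corner by (simp add: scale_mult algebra_simps)
  finally show ?case using Suc.IH[of "Suc n"] Suc.IH[of k] Suc.prems n by (simp add: F_simps)
qed

text \<open>At \<open>i = 0\<close> transfer yields \<open>a ^ Suc n\<close> times the three-term
  recurrence in \<open>y\<close>, which is zero. Absorbing powers of \<open>x\<close> leads down to
  \<open>bern a 0\<close>, whose extra constant produces \<open>F h\<close>.\<close>

lemma bern_moment:
  "degree h = 0 \<Longrightarrow> i \<le> Suc n \<Longrightarrow>
    F (bern a n * h * varx ^ i) = (if i = Suc n then (1/2) ^ Suc n * (1 - a\<^sup>2) * F h else 0)"
proof (induction i arbitrary: n)
  case 0
  note tr = transfer[OF 0(1)] transfer[OF degree_mult_0[OF degree_vary(1) 0(1)]]
  have tr0: "F (cheb n varx * h) * a = a ^ n * F (cheb n vary * h)"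
    by (cases n) (simp_all add: tr F_simps del: cheb.simps(3))
  have "bern a n * h * varx ^ 0 = cheb (Suc (Suc n)) varx * h
      - scale (2 * a) (cheb (Suc n) varx * (vary * h)) + scale (a\<^sup>2) (cheb n varx * h)"
    by (simp add: bern_def scale_cst algebra_simps)
  hence "F (bern a n * h * varx ^ 0) = F (cheb (Suc (Suc n)) varx * h)
      - 2 * a * F (cheb (Suc n) varx * (vary * h)) + a * (F (cheb n varx * h) * a)"
    by (simp only: F_simps) (simp add: power2_eq_square)
  also have "\<dots> = a ^ Suc n * (F (cheb (Suc (Suc n)) vary * h)
      - 2 * F (cheb (Suc n) vary * (vary * h)) + F (cheb n vary * h))"
    unfolding tr tr0 by (simp add: algebra_simps)
  also have "\<dots> = a ^ Suc n * F ((cheb (Suc (Suc n)) vary * h)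
      - scale 2 (cheb (Suc n) vary * (vary * h)) + cheb n vary * h)"
    by (simp only: F_simps)
  also have "(cheb (Suc (Suc n)) vary * h)
      - scale 2 (cheb (Suc n) vary * (vary * h)) + cheb n vary * h = 0"
    by (simp add: scale_cst algebra_simps)
  finally show ?case by (simp add: F_simps)
next
  case (Suc i)
  show ?case
  proof (cases n)
    case 0
    have "bern a 0 * h * varx = varx * bern a 0 * h" by (simp only: mult_ac)
    also have "\<dots> = scale (1/2) (bern a 1 * h * varx ^ 0 + scale (1 - a\<^sup>2) h)"
      unfolding varx_bern_0 by (simp only: scale_cst) (simp add: algebra_simps)
    finally show ?thesis using Suc 0 by (simp add: F_simps del: power_Suc)
  next
    case (Suc k)
    have "bern a n * h * varx ^ Suc i = (varx * bern a n) * h * varx ^ i"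
      by (simp only: mult_ac power_Suc)
    also have "\<dots> = scale (1/2) (bern a (Suc n) * h * varx ^ i + bern a k * h * varx ^ i)"
      unfolding Suc varx_bern_Suc by (simp only: scale_cst) (simp only: algebra_simps)
    finally show ?thesis using Suc.IH[of "Suc n"] Suc.IH[of k] Suc.prems Suc by (simp add: F_simps)
  qed
qed

lemma bern_cheb_moment:
  assumes "i \<le> Suc n"
  shows "F (bern a n * cheb (Suc l) vary * varx ^ i * vary ^ j) =
      (if i = Suc n then (1/2) ^ Suc n * (1 - a\<^sup>2) * F (cheb (Suc l) vary * vary ^ j) else 0)"
proof -
  have h: "degree (cheb (Suc l) vary * vary ^ j) = 0"
    by (intro degree_mult_0 degree_vary)
  have "bern a n * cheb (Suc l) vary * varx ^ i * vary ^ j = bern a n * (cheb (Suc l) vary * vary ^ j) * varx ^ i"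
    by (simp only: mult_ac)
  thus ?thesis using bern_moment[OF h assms] by (simp only:)
qed

lemma corner_orthonormal: "is_orthonormal_poly F (n, m) (lex_below n m m) (corner a n m)"
proof -
  have sub: "{..n} \<times> {..m} = insert (n, m) (lex_below n m m)"
    by (auto simp: lex_below_def)
  have orth: "F (corner a n m * varx ^ i * vary ^ j) = 0" if "(i, j) \<in> lex_below n m m" for i j
    using that by (subst corner_moment) (auto simp: lex_below_def)
  have "F ((corner a n m)\<^sup>2) = 2 ^ (n + m) * F (corner a n m * varx ^ n * vary ^ m)"
    using orthogonal_leading[OF lin, of n m "lex_below n m m"] supported_corner orth
    by (simp add: sub[symmetric] coeff2_corner power2_eq_square)
  also have "\<dots> = 1" by (simp add: corner_moment power_one_over)
  finally show ?thesis using orth supported_corner[of n m a]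
    by (auto simp: is_orthonormal_poly_def supported_def sub[symmetric] coeff2_corner)
qed

lemma lexP_orthonormal:
  assumes "l \<le> m"
  shows "is_orthonormal_poly F (n, l) (lex_below n m l) (lexP a n m l)"
proof (cases "n = 0 \<or> l = m")
  case True
  have "lex_below 0 m l = lex_below 0 l l" using assms by (auto simp: lex_below_def)
  thus ?thesis using corner_orthonormal[of n l] True by (auto simp: lexP_def)
next
  case False
  then obtain k where n: "n = Suc k" by (cases n) auto
  have lm: "l < m" using False assms by auto
  let ?p = "bern a k * cheb (Suc l) vary"
  have supp: "supported (insert (n, l) (lex_below n m l)) ?p"
    using lm by (intro supported_mono[OF supported_bern]) (auto simp: lex_below_def n)
  have orth: "F (?p * varx ^ i * vary ^ j) = 0" if "(i, j) \<in> lex_below n m l" for i j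
    using that by (subst bern_cheb_moment) (auto simp: lex_below_def n cheb_moment)
  have "F (?p\<^sup>2) = 2 ^ (Suc k + l) * F (?p * varx ^ n * vary ^ l)"
    using orthogonal_leading[OF lin supp orth] coeff2_bern[of a k l] by (simp add: n power2_eq_square)
  also have "\<dots> = 1 - a\<^sup>2"
    unfolding n by (subst bern_cheb_moment) (simp_all add: cheb_moment power_add power_one_over)
  finally have norm: "F (?p\<^sup>2) = 1 - a\<^sup>2" .
  show ?thesis
    using orthonormal_poly_normalize[OF pd _ supp orth] coeff2_bern[of a k l] False
    by (simp add: norm n lexP_def)
qed

lemma lex_poly_eq: "l \<le> m \<Longrightarrow> lex_poly F n m l = lexP a n m l"
  using lex_poly_eqI[OF pd] lexP_orthonormal by blast

lemma corner_eq: "lex_poly F n m m = corner a n m"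
  by (simp add: lex_poly_eq lexP_def)

section \<open>The parameters of the coupled functional\<close>

lemma corner_apply:
  assumes "supported ({..n} \<times> {..m}) q"
  shows "F (corner a n m * q) = coeff2 q n m * (1/2) ^ (n + m)"
proof -
  have "F (corner a n m * q) = coeff2 q n m * F (corner a n m * varx ^ n * vary ^ m)"
  proof (rule orthogonal_leading[OF lin])
    show "supported (insert (n, m) (lex_below n m m)) q"
      by (rule supported_mono[OF assms]) (auto simp: lex_below_def)
  qed (subst corner_moment, auto simp: lex_below_def)
  thus ?thesis by (simp add: corner_moment)
qed

lemma corner_norm: "F (corner a n m * corner a n m) = 1"
  by (simp add: corner_apply[OF supported_corner] coeff2_corner power_one_over)

lemma bern_orthogonal:
  assumes "supported ({..n} \<times> UNIV \<union> {Suc n} \<times> {..<l}) q"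
  shows "F (bern a n * cheb (Suc l) vary * q) = 0"
  by (rule orthogonal_supported[OF lin _ assms], subst bern_cheb_moment) (auto simp: cheb_moment)

text \<open>An orthogonal decomposition: the \<open>bern\<close> part is orthogonal to
  \<open>corner a n (Suc m)\<close> and to its product with \<open>vary\<close>. The coefficient
  \<open>a\<close> becomes the value of the \<open>K\<close> entries.\<close>

lemma corner_Suc: "corner a (Suc n) m = bern a n * cheb (Suc m) vary + scale a (corner a n (Suc m))"
  by (simp add: bern_corner)

lemma supported_vary: "supported {(0, 1)} vary"
  using supported_monom[of 0 1 "{(0, 1)}"] by simp

lemma vary_corner_supported: "supported ({..n} \<times> {..Suc m}) (vary * corner a n m)"
  by (rule supported_mult[OF supported_vary supported_corner]) auto

lemma bern_corner_orthogonal: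
  "F (bern a n * cheb (Suc l) vary * corner a n m) = 0"
  "F (bern a n * cheb (Suc l) vary * (vary * corner a n m)) = 0"
  by (auto intro!: bern_orthogonal supported_mono[OF supported_corner] supported_mono[OF vary_corner_supported])

text \<open>Multiplication by \<open>vary\<close> moves the index \<open>l\<close> to its two
  neighbours, and both resulting products are orthogonal to the original one.\<close>

lemma bern_vary: "F (bern a n * cheb (Suc l) vary * (vary * (bern a n * cheb (Suc l) vary))) = 0"
proof -
  have less: "F (bern a n * cheb (Suc (Suc l)) vary * (bern a n * cheb (Suc l) vary)) = 0" for l
    by (intro bern_orthogonal supported_mono[OF supported_bern]) auto
  have "F (bern a n * cheb l vary * (bern a n * cheb (Suc l) vary)) = 0"
    using less[of "l - 1"] by (cases l) (simp_all add: F_simps mult.commute del: cheb.simps(3))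
  moreover have "vary * (bern a n * cheb (Suc l) vary) = bern a n * (vary * cheb (Suc l) vary)"
    by (simp only: mult_ac)
  hence "bern a n * cheb (Suc l) vary * (vary * (bern a n * cheb (Suc l) vary)) =
      scale (1/2) (bern a n * cheb (Suc (Suc l)) vary * (bern a n * cheb (Suc l) vary)
        + bern a n * cheb l vary * (bern a n * cheb (Suc l) vary))"
    unfolding times_cheb scale_cst by (simp only: algebra_simps)
  ultimately show ?thesis using less[of l] by (simp only: F_simps) simp
qed

text \<open>Induction through \<open>corner_Suc\<close>, which lowers \<open>n\<close> but raises
  \<open>m\<close>; hence \<open>m\<close> is arbitrary. The \<open>bern\<close> terms and the mixed
  terms vanish.\<close>

lemma corner_vary: "F (corner a n m * (vary * corner a n m)) = 0"
proof (induction n arbitrary: m)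
  case 0
  have less: "F (corner a 0 (Suc m) * corner a 0 m) = 0" for m
    by (subst corner_apply[OF supported_mono[OF supported_corner]])
       (auto simp: coeff2_unsupported[OF supported_corner])
  show ?case
  proof (cases m)
    case 0
    have "vary * corner a 0 0 = scale (1/2) (corner a 0 1)"
      by (rule half_eq) (simp add: corner_def scale_cst)
    thus ?thesis using less[of 0] 0 by (simp add: scale_mult F_simps mult.commute)
  next
    case (Suc k)
    show ?thesis unfolding Suc vary_corner scale_mult distrib_left F_simps
      using less[of "Suc k"] less[of k] by (simp add: mult.commute)
  qed
next
  case (Suc n)
  let ?b = "bern a n * cheb (Suc m) vary" and ?c = "corner a n (Suc m)"
  have "corner a (Suc n) m * (vary * corner a (Suc n) m) =
     ?b * (vary * ?b) + scale (2 * a) (?b * (vary * ?c)) + scale (a\<^sup>2) (?c * (vary * ?c))"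
    unfolding corner_Suc by (simp add: scale_cst algebra_simps power2_eq_square)
  thus ?case using Suc.IH by (simp only: F_simps bern_vary bern_corner_orthogonal)
qed

lemma K_value: "F (corner a (Suc n) m * corner a n (Suc m)) = a"
  unfolding corner_Suc by (simp add: distrib_right scale_mult F_simps corner_norm bern_corner_orthogonal)

lemma J2_value: "F (vary * corner a (Suc n) m * corner a n (Suc m)) = 0"
proof -
  let ?b = "bern a n * cheb (Suc m) vary" and ?c = "corner a n (Suc m)"
  have "vary * corner a (Suc n) m * ?c = ?b * (vary * ?c) + scale a (?c * (vary * ?c))"
    unfolding corner_Suc by (simp add: scale_cst algebra_simps)
  thus ?thesis by (simp add: F_simps corner_vary bern_corner_orthogonal)
qed

lemma J1_value_diag: "F (vary * corner a (Suc n) m * (bern a n * cheb (Suc m) vary)) = 0"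
proof -
  let ?b = "bern a n * cheb (Suc m) vary" and ?c = "corner a n (Suc m)"
  have "vary * corner a (Suc n) m * ?b = ?b * (vary * ?b) + scale a (?b * (vary * ?c))"
    unfolding corner_Suc by (simp add: scale_cst algebra_simps)
  thus ?thesis by (simp add: F_simps bern_vary bern_corner_orthogonal)
qed

lemma coeff2_vary_mult: "coeff2 (vary * p) i (Suc j) = coeff2 p i j"
  by (simp add: coeff2_def vary_def)

lemma J1_value: "F (vary * corner a n m * corner a n (Suc m)) = 1/2"
  using corner_apply[OF vary_corner_supported, of n m]
  by (simp add: coeff2_vary_mult coeff2_corner mult.commute power_one_over)

end

text \<open>Restates the definition with \<open>lex_poly\<close> alone, by
  \<open>revlex_corner\<close>, and with indices starting at 0 in place of
  \<open>n, m \<ge> 1\<close>.\<close>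

lemma parameter_array_iff:
  "is_parameter_array F s \<longleftrightarrow>
     (\<forall>n m.
        s (2*n + 1) (2*m + 1) = F (lex_poly F (n + 1) m m * lex_poly F n (m + 1) (m + 1)) \<and>
        s (2*n + 1) (2*m + 2) = - F (vary * lex_poly F (n + 1) m m * lex_poly F n (m + 1) (m + 1)) \<and>
        s (2*n + 2) (2*m + 1) = F (vary * lex_poly F (n + 1) m m * lex_poly F (n + 1) (m + 1) m) \<and>
        s (2*n + 2) (2*m + 2) = F (vary * lex_poly F (n + 1) m m * lex_poly F (n + 1) (m + 1) (m + 1))) \<and>
     s 0 0 = F 1 \<and>
     (\<forall>n. varx * lex_poly F n 0 0 =
        scale (s (2*n + 2) 0) (lex_poly F (n + 1) 0 0) +
        scale (s (2*n + 1) 0) (lex_poly F n 0 0) +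
        (if n = 0 then 0 else scale (s (2*n) 0) (lex_poly F (n - 1) 0 0))) \<and>
     (\<forall>m. vary * lex_poly F 0 m m =
        scale (s 0 (2*m + 2)) (lex_poly F 0 (m + 1) (m + 1)) +
        scale (s 0 (2*m + 1)) (lex_poly F 0 m m) +
        (if m = 0 then 0 else scale (s 0 (2*m)) (lex_poly F 0 (m - 1) (m - 1))))"
proof -
  have shift: "(\<forall>n\<ge>1. \<forall>m\<ge>1. P n m) \<longleftrightarrow> (\<forall>n m. P (Suc n) (Suc m))" for P :: "nat \<Rightarrow> nat \<Rightarrow> bool"
    by (metis One_nat_def Suc_le_mono Suc_pred' le0 less_eq_Suc_le)
  show ?thesis
    unfolding is_parameter_array_def shift
    by (simp add: K_mat_def J1_mat_def J2_mat_def gram_def lex_vec_def revlex_vec_def revlex_corner)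
qed

locale chebyshev_parameters =
  fixes s :: "nat \<Rightarrow> nat \<Rightarrow> real" and a :: real
  assumes s00: "s 0 0 = 1"
    and x_axis: "\<And>n. s (2*n + 1) 0 = 0" "\<And>n. s (2*n + 2) 0 = 1/2"
    and y_axis: "\<And>m. s 0 (2*m + 1) = 0" "\<And>m. s 0 (2*m + 2) = 1/2"
    and interior: "\<And>n m. s (2*n + 1) (2*m + 1) = a" "\<And>n m. s (2*n + 1) (2*m + 2) = 0"
      "\<And>n m. s (2*n + 2) (2*m + 1) = 0" "\<And>n m. s (2*n + 2) (2*m + 2) = 1/2"
begin

lemma parameter_array_cheb_iff:
  "is_parameter_array F s \<longleftrightarrow>
     (\<forall>n m.
        a = F (lex_poly F (Suc n) m m * lex_poly F n (Suc m) (Suc m)) \<and>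
        0 = F (vary * lex_poly F (Suc n) m m * lex_poly F n (Suc m) (Suc m)) \<and>
        0 = F (vary * lex_poly F (Suc n) m m * lex_poly F (Suc n) (Suc m) m) \<and>
        1/2 = F (vary * lex_poly F (Suc n) m m * lex_poly F (Suc n) (Suc m) (Suc m))) \<and>
     F 1 = 1 \<and>
     (\<forall>n. varx * lex_poly F n 0 0 =
        scale (1/2) (lex_poly F (Suc n) 0 0 + (if n = 0 then 0 else lex_poly F (n - 1) 0 0))) \<and>
     (\<forall>m. vary * lex_poly F 0 m m =
        scale (1/2) (lex_poly F 0 (Suc m) (Suc m) + (if m = 0 then 0 else lex_poly F 0 (m - 1) (m - 1))))"
proof -
  have ax: "s (2 * n) 0 = 1/2" "s 0 (2 * n) = 1/2" if "n \<noteq> 0" for n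
    using that x_axis(2)[of "n - 1"] y_axis(2)[of "n - 1"] by (cases n; simp)+
  have "scale (1/2) (p + q) = scale (1/2) p + scale (1/2) q" for p q
    by (simp add: scale_cst distrib_left)
  thus ?thesis
    unfolding parameter_array_iff interior x_axis y_axis s00 
    by (simp add: ax cong: if_cong)
qed

end

section \<open>The parameters determine the functional\<close>

lemma lf_eq_mult:
  assumes "linear_functional G" "linear_functional H" "supported A p" "supported B q"
    and "\<And>i j k l. (i, j) \<in> A \<Longrightarrow> (k, l) \<in> B \<Longrightarrow>
      G (varx ^ (i + k) * vary ^ (j + l)) = H (varx ^ (i + k) * vary ^ (j + l))"
  shows "G (p * q) = H (p * q)"
  by (rule linear_functional_eq_on[OF assms(1,2), of "{(i, j). G (varx ^ i * vary ^ j) = H (varx ^ i * vary ^ j)}"])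
     (use assms in \<open>auto intro!: supported_mult[OF assms(3,4)]\<close>)

text \<open>Kept apart from the norm condition because at the top corner orthogonality carries over
  before the norm is known.\<close>

lemma orthogonal_cong:
  assumes "linear_functional G" "linear_functional H" "is_orthonormal_poly H ab B p" "(k, l) \<in> B"
    and "\<And>i j. (i, j) \<in> insert ab B \<Longrightarrow>
      G (varx ^ (i + k) * vary ^ (j + l)) = H (varx ^ (i + k) * vary ^ (j + l))"
  shows "G (p * varx ^ k * vary ^ l) = 0"
proof -
  have "G (p * (varx ^ k * vary ^ l)) = H (p * (varx ^ k * vary ^ l))"
    by (rule lf_eq_mult[OF assms(1,2) orthonormal_poly_supported[OF assms(3)] supported_monom[of k l "{(k, l)}"]])
       (use assms(5) in auto)
  thus ?thesis using assms(3,4) by (auto simp: is_orthonormal_poly_def mult.assoc)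
qed

lemma orthonormal_poly_cong:
  assumes "linear_functional G" "linear_functional H" "is_orthonormal_poly H ab B p"
    and "\<And>i j k l. (i, j) \<in> insert ab B \<Longrightarrow> (k, l) \<in> insert ab B \<Longrightarrow>
      G (varx ^ (i + k) * vary ^ (j + l)) = H (varx ^ (i + k) * vary ^ (j + l))"
  shows "is_orthonormal_poly G ab B p"
proof -
  note supp = orthonormal_poly_supported[OF assms(3)]
  have "G (p * p) = H (p * p)"
    by (rule lf_eq_mult[OF assms(1,2) supp supp assms(4)])
  moreover have "G (p * varx ^ k * vary ^ l) = 0" if "(k, l) \<in> B" for k l
    by (rule orthogonal_cong[OF assms(1-3) that]) (use assms(4) that in auto)
  ultimately show ?thesis
    using assms(3) by (auto simp: is_orthonormal_poly_def power2_eq_square)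
qed

locale chebyshev_model = coupled_chebyshev F a + chebyshev_parameters s a
  for F :: "bipoly \<Rightarrow> real" and s :: "nat \<Rightarrow> nat \<Rightarrow> real" and a :: real
begin

lemma corner_axes: "corner a n 0 = cheb (Suc n) varx" "corner a 0 m = cheb (Suc m) vary"
  by (simp_all add: corner_def)

lemma lex_poly_bern:
  "lex_poly F (Suc n) (Suc m) m = scale (1 / sqrt (1 - a\<^sup>2)) (bern a n * cheb (Suc m) vary)"
  by (simp add: lex_poly_eq lexP_def)

lemma axis_recurrence:
  "z * cheb (Suc n) z = scale (1/2) (cheb (Suc (Suc n)) z + (if n = 0 then 0 else cheb (Suc (n - 1)) z))"
  unfolding times_cheb by (cases n) simp_all

lemma is_parameter_array: "is_parameter_array F s"
  unfolding parameter_array_cheb_iff corner_eq corner_axes lex_poly_bern axis_recurrence[symmetric]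
  using F_cheb[of 0] by (simp add: K_value J2_value J1_value_diag J1_value scale_mult F_simps)

context
  fixes G assumes G: "positive_definite G" and par: "is_parameter_array G s"
begin

lemma linG: "linear_functional G"
  using G by (simp add: positive_definite_def)

definition agree :: "nat \<Rightarrow> nat \<Rightarrow> bool" where
  "agree i j \<longleftrightarrow> G (varx ^ i * vary ^ j) = F (varx ^ i * vary ^ j)"

text \<open>By the third hypothesis, the target exponents arise in \<open>p * q\<close> only from
  the two leading terms, and every other monomial of the product already has the same moment under
  \<open>G\<close> and \<open>F\<close>. One equation between values then settles the
  target.\<close>

lemma agree_extend:
  assumes "supported A p" "supported B q"
    and "\<And>k l k' l'. (k, l) \<in> A \<Longrightarrow> (k', l') \<in> B \<Longrightarrow>
      k = i \<and> l = j \<and> k' = i' \<and> l' = j' \<or>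
      (k + k' \<noteq> i + i' \<or> l + l' \<noteq> j + j') \<and> agree (k + k') (l + l')"
    and "coeff2 p i j \<noteq> 0" "coeff2 q i' j' \<noteq> 0" "G (p * q) = F (p * q)"
  shows "agree (i + i') (j + j')"
  unfolding agree_def
proof (rule linear_functional_extend[OF linG lin, of "Collect (case_prod agree)"])
  show "supported (insert (i + i', j + j') (Collect (case_prod agree))) (p * q)"
    by (rule supported_mult[OF assms(1,2)]) (use assms(3) in force)
  have "coeff2 (p * q) (i + i') (j + j') = coeff2 p i j * coeff2 q i' j'"
  proof (rule coeff2_mult_top[OF assms(1,2)])
    fix k l assume "k \<le> i + i'" "l \<le> j + j'" "(k, l) \<in> A" "(i + i' - k, j + j' - l) \<in> B"
    thus "k = i \<and> l = j" using assms(3)[of k l "i + i' - k" "j + j' - l"] by auto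
  qed
  thus "coeff2 (p * q) (i + i') (j + j') \<noteq> 0" using assms by simp
qed (use assms in \<open>auto simp: agree_def\<close>)

text \<open>Testing orthonormality in bidegree \<open>(n, m)\<close> uses products of two such
  polynomials, hence moments up to \<open>(2n, 2m)\<close>.\<close>

lemma agree_corner:
  assumes "\<And>i j. i \<le> 2 * n \<Longrightarrow> j \<le> 2 * m \<Longrightarrow> agree i j"
  shows "lex_poly G n m m = corner a n m"
  by (rule lex_poly_eqI[OF G], rule orthonormal_poly_cong[OF linG lin corner_orthonormal])
     (use assms in \<open>auto simp: agree_def lex_below_def\<close>)

text \<open>The new moments are reached in the order \<open>(2n+1, 2m+1)\<close> from
  \<open>K\<close>, \<open>(2n+1, 2m+2)\<close> from \<open>J2\<close>, \<open>(2n+2, 2m+1)\<close>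
  from the diagonal entry of \<open>J1\<close>, and \<open>(2n+2, 2m+2)\<close> from its last
  entry.\<close>

lemma agree_step:
  assumes x: "\<And>i j. i \<le> 2 * Suc n \<Longrightarrow> j \<le> 2 * m \<Longrightarrow> agree i j"
    and y: "\<And>i j. i \<le> 2 * n \<Longrightarrow> j \<le> 2 * Suc m \<Longrightarrow> agree i j"
    and "i \<le> 2 * Suc n" "j \<le> 2 * Suc m"
  shows "agree i j"
proof -
  let ?p = "corner a (Suc n) m" and ?q = "corner a n (Suc m)"
  have cx: "lex_poly G (Suc n) m m = ?p" by (rule agree_corner) (rule x)
  have cy: "lex_poly G n (Suc m) (Suc m) = ?q" by (rule agree_corner) (rule y)
  have K: "G (?p * ?q) = a" and J2: "G (vary * ?p * ?q) = 0"
    and J1d: "G (vary * ?p * lex_poly G (Suc n) (Suc m) m) = 0"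
    and J1: "G (vary * ?p * lex_poly G (Suc n) (Suc m) (Suc m)) = 1/2"
    using par unfolding parameter_array_cheb_iff by (metis cx cy)+
  have cp: "coeff2 ?p (Suc n) m \<noteq> 0" and cq: "coeff2 ?q n (Suc m) \<noteq> 0"
    and cvp: "coeff2 (vary * ?p) (Suc n) (Suc m) \<noteq> 0"
    by (simp_all add: coeff2_vary_mult coeff2_corner)
  have 1: "agree (Suc n + n) (m + Suc m)"
    by (rule agree_extend[OF supported_corner supported_corner _ cp cq])
       (use K in \<open>auto simp: K_value intro: x y\<close>)
  have known1: "agree i j"
    if ij: "i \<le> Suc (2 * n)" "j \<le> 2 * Suc m" "(i, j) \<noteq> (Suc n + n, Suc m + Suc m)" for i j
  proof -
    consider "j \<le> 2 * m" | "i \<le> 2 * n" | "i = Suc n + n" "j = m + Suc m"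
      using ij by fastforce
    thus ?thesis by cases (use ij 1 x y in auto)
  qed
  have 2: "agree (Suc n + n) (Suc m + Suc m)"
    by (rule agree_extend[OF vary_corner_supported supported_corner _ cvp cq])
       (use J2 in \<open>auto simp: J2_value intro!: known1\<close>)
  have known: "agree i j"
    if ij: "i \<le> 2 * Suc n" "j \<le> 2 * m \<or> i \<le> Suc (2 * n) \<and> j \<le> 2 * Suc m" for i j
    using ij 2 x known1 by (cases "(i, j) = (Suc n + n, Suc m + Suc m)") blast+
  let ?b = "bern a n * cheb (Suc m) vary" and ?r = "1 / sqrt (1 - a\<^sup>2)"
  \<comment> \<open>All moments involved are known: two factors of top \<open>x\<close>-degree
    \<open>Suc n\<close> have total \<open>y\<close>-degree at most \<open>2 * m\<close>.\<close>
  have "is_orthonormal_poly G (Suc n, m) (lex_below (Suc n) (Suc m) m) (lex_poly F (Suc n) (Suc m) m)"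
    by (rule orthonormal_poly_cong[OF linG lin lex_poly_orthonormal[OF pd]])
       (auto simp: lex_below_def agree_def[symmetric] intro!: known)
  hence lb: "lex_poly G (Suc n) (Suc m) m = scale ?r ?b"
    unfolding lex_poly_bern by (rule lex_poly_eqI[OF G])
  have cb: "coeff2 ?b (Suc n) m \<noteq> 0" by (simp add: coeff2_bern)
  have r: "?r \<noteq> 0" using a2 by simp
  have 3: "agree (Suc n + Suc n) (Suc m + m)"
  proof (rule agree_extend[OF vary_corner_supported supported_bern _ cvp cb])
    show "G (vary * ?p * ?b) = F (vary * ?p * ?b)"
      using J1d r unfolding lb J1_value_diag scale_mult lf_scale[OF linG] by (simp only: mult_eq_0_iff) simp
  qed (auto intro!: known)
  have known': "agree i j" if ij: "i \<le> 2 * Suc n" "j \<le> 2 * Suc m" "(i, j) \<noteq> (Suc n + Suc n, Suc m + Suc m)" for i j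
  proof -
    consider "j \<le> 2 * m \<or> i \<le> Suc (2 * n)" | "i = Suc n + Suc n" "j = Suc m + m"
      using ij by fastforce
    thus ?thesis by cases (use ij 3 known in auto)
  qed
  \<comment> \<open>Only the norm of the corner polynomial is still undetermined; \<open>J1\<close> fixes it by the normalization.\<close>
  let ?c = "corner a (Suc n) (Suc m)" and ?B = "lex_below (Suc n) (Suc m) (Suc m)"
  have orth: "G (?c * varx ^ k * vary ^ l) = 0" if "(k, l) \<in> ?B" for k l
    by (rule orthogonal_cong[OF linG lin corner_orthonormal that])
       (use that in \<open>auto simp: lex_below_def agree_def[symmetric] intro!: known'\<close>)
  have sub: "insert (Suc n, Suc m) ?B = {..Suc n} \<times> {..Suc m}"
    by (auto simp: lex_below_def)
  have cc: "coeff2 ?c (Suc n) (Suc m) \<noteq> 0" by (simp add: coeff2_corner)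
  define t where "t = G (?c\<^sup>2)"
  have "?c \<noteq> 0" using cc by auto
  hence t: "t > 0" unfolding t_def using G by (auto simp: positive_definite_def)
  have "is_orthonormal_poly G (Suc n, Suc m) ?B (scale (1 / sqrt t) ?c)"
    unfolding t_def
    by (rule orthonormal_poly_normalize[OF G]) (use orth in \<open>auto simp: sub coeff2_corner supported_corner\<close>)
  hence lc: "lex_poly G (Suc n) (Suc m) (Suc m) = scale (1 / sqrt t) ?c"
    by (rule lex_poly_eqI[OF G])
  have lead: "G (?c * q) = coeff2 q (Suc n) (Suc m) * G (?c * varx ^ Suc n * vary ^ Suc m)"
    if "supported ({..Suc n} \<times> {..Suc m}) q" for q
    using orthogonal_leading[OF linG, of "Suc n" "Suc m" ?B q ?c] orth that unfolding sub by blast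
  \<comment> \<open>Both sides pair \<open>?c\<close> with a polynomial of the same leading
    monomial; the factor 2 is the ratio of the leading coefficients of \<open>?c\<close> and
    \<open>vary * ?p\<close>.\<close>
  have "t = 2 * G (?c * (vary * ?p))"
    using lead[OF supported_corner] lead[OF vary_corner_supported]
    by (simp add: t_def power2_eq_square coeff2_corner coeff2_vary_mult)
  moreover have "G (?c * (vary * ?p)) = sqrt t / 2"
    using J1 t unfolding lc scale_mult lf_scale[OF linG] by (simp add: field_simps)
  ultimately have "t = sqrt t" by simp
  hence "t = 1" using t by (metis less_numeral_extra(3) real_sqrt_eq_1_iff real_sqrt_eq_iff real_sqrt_pow2 power2_eq_square mult_cancel_right2 less_imp_le)
  hence 4: "agree (Suc n + Suc n) (Suc m + Suc m)"
    by (intro agree_extend[OF supported_corner supported_corner _ cc cc])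
       (auto simp: t_def corner_norm power2_eq_square intro!: known')
  show ?thesis using known'[OF assms(3,4)] 4 by blast
qed

section \<open>Moments on the axes and the induction over all moments\<close>

lemma three_term_unique:
  fixes p q :: "nat \<Rightarrow> bipoly"
  assumes "p 0 = q 0"
    and "\<And>n. z * p n = scale (1/2) (p (Suc n) + (if n = 0 then 0 else p (n - 1)))"
    and "\<And>n. z * q n = scale (1/2) (q (Suc n) + (if n = 0 then 0 else q (n - 1)))"
  shows "p n = q n"
proof -
  have step: "r (Suc n) = 2 * z * r n - (if n = 0 then 0 else r (n - 1))"
    if "\<And>n. z * r n = scale (1/2) (r (Suc n) + (if n = 0 then 0 else r (n - 1)))" for r n
  proof -
    have "scale 2 (z * r n) = r (Suc n) + (if n = 0 then 0 else r (n - 1))"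
      unfolding that[of n] by simp
    thus ?thesis by (simp add: scale_cst mult.assoc)
  qed
  show ?thesis
  proof (induction n rule: less_induct)
    case (less n)
    show ?case
    proof (cases n)
      case (Suc k)
      show ?thesis unfolding Suc step[OF assms(2)] step[OF assms(3)]
        using less[of k] less[of "k - 1"] Suc by auto
    qed (use assms in simp)
  qed
qed

lemma lex_poly_origin: "lex_poly G 0 0 0 = 1"
proof (rule lex_poly_eqI[OF G])
  have "G 1 = 1" using par by (simp add: parameter_array_cheb_iff)
  thus "is_orthonormal_poly G (0, 0) (lex_below 0 0 0) 1"
    using coeff2_monom[of 0 0] by (auto simp: is_orthonormal_poly_def lex_below_def split: if_splits)
qed

lemma axis_eq:
  "lex_poly G n 0 0 = cheb (Suc n) varx" "lex_poly G 0 m m = cheb (Suc m) vary"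
proof -
  have rec: "\<And>n. varx * lex_poly G n 0 0 =
        scale (1/2) (lex_poly G (Suc n) 0 0 + (if n = 0 then 0 else lex_poly G (n - 1) 0 0))"
      "\<And>m. vary * lex_poly G 0 m m =
        scale (1/2) (lex_poly G 0 (Suc m) (Suc m) + (if m = 0 then 0 else lex_poly G 0 (m - 1) (m - 1)))"
    using par unfolding parameter_array_cheb_iff by blast+
  show "lex_poly G n 0 0 = cheb (Suc n) varx"
    by (rule three_term_unique[where z = varx]) (simp add: lex_poly_origin, rule rec, rule axis_recurrence)
  show "lex_poly G 0 m m = cheb (Suc m) vary"
    by (rule three_term_unique[where z = vary]) (simp add: lex_poly_origin, rule rec, rule axis_recurrence)
qed

lemma axis_value:
  "G (lex_poly G n 0 0) = (if n = 0 then 1 else 0)" "G (lex_poly G 0 n n) = (if n = 0 then 1 else 0)"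
proof -
  have "G 1 = 1" using par by (simp add: parameter_array_cheb_iff)
  thus "G (lex_poly G n 0 0) = (if n = 0 then 1 else 0)" "G (lex_poly G 0 n n) = (if n = 0 then 1 else 0)"
    using orthonormal_poly_orthogonal[OF linG lex_poly_orthonormal[OF G] supported_monom[of 0 0], of n 0 0]
      orthonormal_poly_orthogonal[OF linG lex_poly_orthonormal[OF G] supported_monom[of 0 0], of 0 n n]
    by (auto simp: lex_poly_origin lex_below_def)
qed

lemma F_cheb_x: "F (cheb (Suc n) varx) = (if n = 0 then 1 else 0)"
  using transfer[of 1 n] F_cheb[of n] by auto

lemma agree_x: "agree i 0"
proof (induction i rule: less_induct)
  case (less i)
  have one: "supported {(0, 0)} 1" "coeff2 1 0 0 \<noteq> 0"
    using supported_monom[of 0 0 "{(0, 0)}"] coeff2_monom[of 0 0 0 0] by simp_all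
  \<comment> \<open>The trivial second factor 1 brings the value of \<open>G\<close> on
    \<open>U\<^sub>i(x)\<close> into the product form of \<open>agree_extend\<close>.\<close>
  have "agree (i + 0) (0 + 0)"
  proof (rule agree_extend[OF supported_corner one(1)])
    show "G (corner a i 0 * 1) = F (corner a i 0 * 1)"
      using axis_value(1)[of i] axis_eq(1)[of i] F_cheb_x[of i] by (simp add: corner_axes)
  qed (use less one in \<open>auto simp: coeff2_corner\<close>)
  thus ?case by simp
qed

lemma agree_y: "agree 0 j"
proof (induction j rule: less_induct)
  case (less j)
  have one: "supported {(0, 0)} 1" "coeff2 1 0 0 \<noteq> 0"
    using supported_monom[of 0 0 "{(0, 0)}"] coeff2_monom[of 0 0 0 0] by simp_all
  have "agree (0 + 0) (j + 0)"
  proof (rule agree_extend[OF supported_corner one(1)])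
    show "G (corner a 0 j * 1) = F (corner a 0 j * 1)"
      using axis_value(2)[of j] axis_eq(2)[of j] F_cheb[of j] by (simp add: corner_axes)
  qed (use less one in \<open>auto simp: coeff2_corner\<close>)
  thus ?case by simp
qed

lemma agree_all: "agree i j"
proof -
  \<comment> \<open>Rectangles with even sides, since \<open>agree_step\<close> enlarges each side
    by two.\<close>
  have "\<forall>i\<le>2*n. \<forall>j\<le>2*m. agree i j" for n m
  proof (induction n arbitrary: m)
    case 0
    show ?case using agree_y by auto
  next
    case (Suc n)
    note n = Suc
    show ?case
    proof (induction m)
      case 0
      show ?case using agree_x by auto
    next
      case (Suc m)
      show ?case using agree_step[of n m] Suc n[of "Suc m"] by blast
    qed
  qed
  from this[of i j] show ?thesis by auto
qed

lemma functional_unique: "G = F"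
proof
  fix p
  show "G p = F p"
    by (rule linear_functional_eq_on[OF linG lin, of UNIV])
       (use agree_all in \<open>auto simp: agree_def supported_def\<close>)
qed

end
end

section \<open>Integration against the measure\<close>

lemma sin_cheb: "sin \<theta> * cheb n (cos \<theta>) = sin (real n * \<theta>)"
proof (induction n "cos \<theta>" rule: cheb.induct)
  case (3 n)
  have e: "real (Suc (Suc n)) * \<theta> = real (Suc n) * \<theta> + \<theta>" "real n * \<theta> = real (Suc n) * \<theta> - \<theta>"
    by (simp_all add: algebra_simps)
  have "sin \<theta> * cheb (Suc (Suc n)) (cos \<theta>) = 2 * cos \<theta> * sin (real (Suc n) * \<theta>) - sin (real n * \<theta>)"
    using 3 by (simp add: algebra_simps)
  also have "\<dots> = sin (real (Suc (Suc n)) * \<theta>)"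
    unfolding e by (simp add: sin_add sin_diff)
  finally show ?case .
qed auto

lemma continuous_on_cheb [continuous_intros]:
  fixes f :: "'a::topological_space \<Rightarrow> real"
  shows "continuous_on S f \<Longrightarrow> continuous_on S (\<lambda>x. cheb n (f x))"
proof (induction n "0::real" rule: cheb.induct)
  case (3 n)
  thus ?case by (auto intro!: continuous_intros)
qed auto

text \<open>With the square root included, the functions become \<open>sin (n * t)\<close> at
  \<open>x = cos t\<close> and are bounded by 1 uniformly in \<open>n\<close>, whereas
  \<open>U\<^sub>n\<close> itself grows at the endpoints.\<close>

definition wcheb :: "nat \<Rightarrow> real \<Rightarrow> real" where
  "wcheb n x = sqrt (1 - x\<^sup>2) * cheb n x"

lemma wcheb_arccos:
  assumes "\<bar>x\<bar> \<le> 1"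
  shows "wcheb n x = sin (real n * arccos x)"
  using assms sin_cheb[of "arccos x" n] by (simp add: wcheb_def sin_arccos abs_le_iff)

lemma wcheb_bound: "\<bar>x\<bar> \<le> 1 \<Longrightarrow> \<bar>wcheb n x\<bar> \<le> 1"
  by (simp add: wcheb_arccos abs_sin_le_one)

lemma continuous_on_wcheb [continuous_intros]:
  "continuous_on S f \<Longrightarrow> continuous_on S (\<lambda>x. wcheb n (f x))"
  unfolding wcheb_def by (intro continuous_intros)

text \<open>The substitution \<open>x = cos t\<close> in the form of an explicit antiderivative. The
  interior version of the fundamental theorem is needed because the derivative of
  \<open>arccos\<close> blows up at the endpoints.\<close>

lemma integral_cheb_orthogonal:
  "integral {-1..1} (\<lambda>x. wcheb (Suc m) x * cheb (Suc n) x) = (if m = n then pi/2 else 0)"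
proof -
  \<comment> \<open>A primitive of \<open>sin ((m+1) * t) * sin ((n+1) * t)\<close> from the
    product-to-sum formula; for \<open>m = n\<close> the first denominator would vanish.\<close>
  define \<Phi> where "\<Phi> t = (if m = n then t / 2 - sin (2 * real (Suc n) * t) / (4 * real (Suc n))
    else sin ((real m - real n) * t) / (2 * (real m - real n))
       - sin ((real m + real n + 2) * t) / (2 * (real m + real n + 2)))" for t
  have ev: "(real m + real n + 2) * t = real (Suc m) * t + real (Suc n) * t"
    "(real m - real n) * t = real (Suc m) * t - real (Suc n) * t" 
    "2 * real (Suc n) * t = real (Suc n) * t + real (Suc n) * t" for t
    by (simp_all add: algebra_simps)
  have d\<Phi>: "(\<Phi> has_real_derivative sin (real (Suc m) * t) * sin (real (Suc n) * t)) (at t)" for t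
  proof (cases "m = n")
    case True
    have "(\<Phi> has_real_derivative (1 / 2 - cos (2 * real (Suc n) * t) / 2)) (at t)"
      unfolding \<Phi>_def[abs_def] using True
      by (auto intro!: derivative_eq_intros simp: divide_simps) (simp add: algebra_simps)
    moreover have "1 / 2 - cos (2 * real (Suc n) * t) / 2 = sin (real (Suc m) * t) * sin (real (Suc n) * t)"
      using True cos_double_sin[of "real (Suc n) * t"]
      by (simp only: mult.assoc) (simp add: power2_eq_square field_simps)
    ultimately show ?thesis by simp
  next
    case False
    have "(\<Phi> has_real_derivative (cos ((real m - real n) * t) / 2 - cos ((real m + real n + 2) * t) / 2)) (at t)"
      unfolding \<Phi>_def[abs_def] using False
      by (auto intro!: derivative_eq_intros simp: divide_simps) (simp add: algebra_simps)
    moreover have "cos ((real m - real n) * t) / 2 - cos ((real m + real n + 2) * t) / 2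
        = sin (real (Suc m) * t) * sin (real (Suc n) * t)"
      unfolding ev cos_add cos_diff by (simp add: diff_divide_distrib add_divide_distrib)
    ultimately show ?thesis by simp
  qed
  have "((\<lambda>x. wcheb (Suc m) x * cheb (Suc n) x) has_integral (- \<Phi> (arccos 1) - - \<Phi> (arccos (-1)))) {-1..1}"
  proof (rule fundamental_theorem_of_calculus_interior)
    have "continuous_on UNIV \<Phi>"
      using d\<Phi> by (meson DERIV_isCont continuous_at_imp_continuous_on)
    thus "continuous_on {-1..1} (\<lambda>x. - \<Phi> (arccos x))"
      by (intro continuous_on_minus continuous_on_compose2[OF _ continuous_on_arccos']) auto
    fix x :: real assume x: "x \<in> {-1<..<1}"
    define t where "t = arccos x"
    have "x\<^sup>2 < 1" using x by (subst abs_square_less_1) auto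
    hence s: "sqrt (1 - x\<^sup>2) \<noteq> 0" by simp
    have ct: "cos t = x" "sin t = sqrt (1 - x\<^sup>2)" using x by (simp_all add: t_def sin_arccos)
    have "((\<lambda>x. - \<Phi> (arccos x)) has_real_derivative
        - (sin (real (Suc m) * t) * sin (real (Suc n) * t) * inverse (- sqrt (1 - x\<^sup>2)))) (at x)"
      unfolding t_def using x by (intro DERIV_minus DERIV_chain2[OF d\<Phi>] DERIV_arccos) auto
    moreover have "- (sin (real (Suc m) * t) * sin (real (Suc n) * t) * inverse (- sqrt (1 - x\<^sup>2))) =
        wcheb (Suc m) x * cheb (Suc n) x"
      unfolding sin_cheb[symmetric] ct wcheb_def using s by (simp add: field_simps)
    ultimately show "((\<lambda>x. - \<Phi> (arccos x)) has_vector_derivative wcheb (Suc m) x * cheb (Suc n) x) (at x)"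
      by (simp add: has_real_derivative_iff_has_vector_derivative)
  qed simp
  moreover have "sin ((real m - real n) * pi) = 0" "sin ((real m + real n + 2) * pi) = 0"
      "sin (2 * real (Suc n) * pi) = 0"
    unfolding ev sin_add sin_diff by (simp_all only: sin_npi mult_zero_left mult_zero_right cos_npi)
  hence "- \<Phi> (arccos 1) - - \<Phi> (arccos (-1)) = (if m = n then pi/2 else 0)"
    by (simp add: \<Phi>_def)
  ultimately show ?thesis by (simp add: integral_unique)
qed

section \<open>Positivity of the denominator and the Poisson kernel\<close>

definition denom :: "real \<Rightarrow> real \<Rightarrow> real \<Rightarrow> real" where
  "denom a x y = 4 * a\<^sup>2 * (x\<^sup>2 + y\<^sup>2) - 4 * a * (1 + a\<^sup>2) * x * y + (1 - a\<^sup>2)\<^sup>2"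

text \<open>Passing to \<open>t = \<bar>a\<bar>\<close> and \<open>s = \<bar>x * y\<bar>\<close>
  only lowers the value, giving
  \<open>(1 - t\<^sup>2)\<^sup>2 - 4 * t * s * (1 - t)\<^sup>2\<close>; with
  \<open>s \<le> 1\<close> this is at least \<open>(1 - t) ^ 4\<close>.\<close>

lemma denom_pos:
  assumes a: "\<bar>a\<bar> < 1" and xy: "\<bar>x\<bar> \<le> 1" "\<bar>y\<bar> \<le> 1"
  shows "denom a x y > 0"
proof -
  define t where "t = \<bar>a\<bar>"
  define s where "s = \<bar>x * y\<bar>"
  have t: "0 \<le> t" "t < 1" and s: "0 \<le> s" "s \<le> 1"
    using a xy by (auto simp: t_def s_def abs_mult mult_le_one)
  have a2: "a\<^sup>2 = t\<^sup>2" by (simp add: t_def)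
  have "0 \<le> (\<bar>x\<bar> - \<bar>y\<bar>)\<^sup>2" by simp
  hence "2 * s \<le> x\<^sup>2 + y\<^sup>2" by (simp add: s_def power2_diff abs_mult)
  hence 1: "4 * t\<^sup>2 * (2 * s) \<le> 4 * a\<^sup>2 * (x\<^sup>2 + y\<^sup>2)"
    unfolding a2 by (intro mult_left_mono) auto
  have "a * (x * y) \<le> t * s" unfolding t_def s_def by (metis abs_ge_self abs_mult)
  hence "4 * (1 + a\<^sup>2) * (a * (x * y)) \<le> 4 * (1 + t\<^sup>2) * (t * s)"
    unfolding a2 by (intro mult_left_mono) auto
  hence 2: "4 * a * (1 + a\<^sup>2) * x * y \<le> 4 * (1 + t\<^sup>2) * (t * s)" by (simp add: algebra_simps)
  have "t * s * (1 - t)\<^sup>2 \<le> t * 1 * (1 - t)\<^sup>2"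
    using s t by (intro mult_right_mono mult_left_mono) auto
  hence "(1 - t\<^sup>2)\<^sup>2 + 4 * t\<^sup>2 * (2 * s) - 4 * (1 + t\<^sup>2) * (t * s) \<ge> (1 - t) ^ 4"
    by (simp add: power2_eq_square power4_eq_xxxx algebra_simps)
  moreover have "(1 - t) ^ 4 > 0" using t by simp
  ultimately show ?thesis using 1 2 unfolding denom_def a2 by linarith
qed

lemma weight_eq: "weight a (x, y) =
    4 / pi\<^sup>2 * ((1 - a\<^sup>2) * sqrt (1 - x\<^sup>2) * sqrt (1 - y\<^sup>2) / denom a x y)"
  by (simp add: weight_def denom_def)

text \<open>
  The products \<open>c k\<close> satisfy a recurrence of order four whose coefficients are those of \<open>denom a x y\<close>
  expanded in powers of \<open>a\<close>, so that only initial terms survive in \<open>denom a x y\<close> times the series.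
\<close>

lemma poisson_kernel:
  assumes a: "\<bar>a\<bar> < 1" and xy: "\<bar>x\<bar> \<le> 1" "\<bar>y\<bar> \<le> 1"
  shows "(\<lambda>k. 4 / pi\<^sup>2 * (a ^ k * (wcheb (Suc k) x * wcheb (Suc k) y))) sums weight a (x, y)"
proof -
  define c where "c k = wcheb (Suc k) x * wcheb (Suc k) y" for k
  define f where "f k = a ^ k * c k" for k
  let ?s = "sqrt (1 - x\<^sup>2) * sqrt (1 - y\<^sup>2)"
  have "summable f"
  proof (rule summable_comparison_test')
    show "summable (\<lambda>k. \<bar>a\<bar> ^ k)" using a by (simp add: summable_geometric)
    show "norm (f k) \<le> \<bar>a\<bar> ^ k" for k
      using xy mult_left_mono[OF mult_le_one[OF wcheb_bound[OF xy(1), of "Suc k"] abs_ge_zero wcheb_bound[OF xy(2), of "Suc k"]], of "\<bar>a\<bar> ^ k"]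
      by (simp add: f_def c_def abs_mult power_abs)
  qed
  hence sh: "(\<lambda>k. f (k + n)) sums (suminf f - sum f {..<n})" for n
    by (simp add: sums_iff_shift summable_sums)
  have rec: "c (k + 4) = 4 * x * y * c (k + 3) - (4 * x\<^sup>2 + 4 * y\<^sup>2 - 2) * c (k + 2) + 4 * x * y * c (k + 1) - c k" for k
    by (simp add: c_def wcheb_def numeral_eq_Suc) (simp add: algebra_simps)
  \<comment> \<open>The term \<open>f (k + 0)\<close> keeps all five shifts in the form of
    \<open>sh\<close>.\<close>
  have frec: "f (k + 4) - 4 * x * y * a * f (k + 3) + (4 * x\<^sup>2 + 4 * y\<^sup>2 - 2) * a\<^sup>2 * f (k + 2)
      - 4 * x * y * a ^ 3 * f (k + 1) + a ^ 4 * f (k + 0) = 0" for k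
    unfolding f_def rec by (simp add: power_add algebra_simps eval_nat_numeral)
  have "(\<lambda>k. f (k + 4) - 4 * x * y * a * f (k + 3) + (4 * x\<^sup>2 + 4 * y\<^sup>2 - 2) * a\<^sup>2 * f (k + 2)
      - 4 * x * y * a ^ 3 * f (k + 1) + a ^ 4 * f (k + 0)) sums
      ((suminf f - sum f {..<4}) - 4 * x * y * a * (suminf f - sum f {..<3})
      + (4 * x\<^sup>2 + 4 * y\<^sup>2 - 2) * a\<^sup>2 * (suminf f - sum f {..<2})
      - 4 * x * y * a ^ 3 * (suminf f - sum f {..<1}) + a ^ 4 * (suminf f - sum f {..<0}))"
    by (intro sums_add sums_diff sums_mult sh)
  hence "(suminf f - sum f {..<4}) - 4 * x * y * a * (suminf f - sum f {..<3})
      + (4 * x\<^sup>2 + 4 * y\<^sup>2 - 2) * a\<^sup>2 * (suminf f - sum f {..<2})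
      - 4 * x * y * a ^ 3 * (suminf f - sum f {..<1}) + a ^ 4 * (suminf f - sum f {..<0}) = 0"
    unfolding frec by (simp add: sums_iff)
  hence "denom a x y * suminf f = sum f {..<4} - 4 * x * y * a * sum f {..<3}
      + (4 * x\<^sup>2 + 4 * y\<^sup>2 - 2) * a\<^sup>2 * sum f {..<2} - 4 * x * y * a ^ 3 * sum f {..<1}"
    unfolding denom_def by (simp add: algebra_simps eval_nat_numeral)
  also have "\<dots> = (1 - a\<^sup>2) * ?s"
    by (simp add: f_def c_def wcheb_def eval_nat_numeral) (simp add: algebra_simps)
  finally have "suminf f = (1 - a\<^sup>2) * ?s / denom a x y"
    using denom_pos[OF assms] by (simp add: field_simps)
  hence "4 / pi\<^sup>2 * suminf f = weight a (x, y)"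
    by (simp add: weight_eq mult.assoc)
  thus ?thesis
    using sums_mult[OF summable_sums[OF \<open>summable f\<close>], of "4 / pi\<^sup>2"] by (simp add: f_def c_def)
qed

section \<open>Integration over the square\<close>

abbreviation square :: "(real \<times> real) set" where
  "square \<equiv> cbox (-1, -1) (1, 1)"

lemma square_iff: "(x, y) \<in> square \<longleftrightarrow> \<bar>x\<bar> \<le> 1 \<and> \<bar>y\<bar> \<le> 1"
  by (auto simp: cbox_Pair_eq abs_le_iff)

lemma continuous_on_weight: "\<bar>a\<bar> < 1 \<Longrightarrow> continuous_on square (weight a)"
proof -
  assume a: "\<bar>a\<bar> < 1"
  have "continuous_on square (\<lambda>z. 4 / pi\<^sup>2 *
      ((1 - a\<^sup>2) * sqrt (1 - (fst z)\<^sup>2) * sqrt (1 - (snd z)\<^sup>2) / denom a (fst z) (snd z)))"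
    using denom_pos[OF a] unfolding denom_def
    by (intro continuous_intros) (metis square_iff less_irrefl prod.collapse)
  thus ?thesis by (rule continuous_on_cong[THEN iffD1, rotated -1]) (auto simp: weight_eq)
qed

lemma weight_nonneg: "\<bar>a\<bar> < 1 \<Longrightarrow> z \<in> square \<Longrightarrow> weight a z \<ge> 0"
  using denom_pos[of a "fst z" "snd z"]
  by (cases z) (auto simp: weight_eq square_iff abs_square_le_1 less_imp_le)

lemma weight_pos: "\<bar>a\<bar> < 1 \<Longrightarrow> \<bar>x\<bar> < 1 \<Longrightarrow> \<bar>y\<bar> < 1 \<Longrightarrow> weight a (x, y) > 0"
  using denom_pos[of a x y] by (auto simp: weight_eq abs_square_less_1)

lemma eval2_simps [simp]:
  "eval2 0 z = 0" "eval2 1 z = 1"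
  "eval2 (p + q) z = eval2 p z + eval2 q z"
  "eval2 (p - q) z = eval2 p z - eval2 q z"
  "eval2 (p * q) z = eval2 p z * eval2 q z"
  "eval2 (scale c p) z = c * eval2 p z"
  "eval2 (p ^ n) z = eval2 p z ^ n"
  "eval2 varx z = fst z" "eval2 vary z = snd z" "eval2 (numeral k) z = numeral k"
  by (simp_all add: eval2_def scale_def varx_def vary_def numeral_poly)

lemma eval2_cheb: "eval2 (cheb n p) z = cheb n (eval2 p z)"
  by (induction n p rule: cheb.induct) auto

lemma continuous_on_eval2 [continuous_intros]: "continuous_on S (eval2 p)"
proof -
  have sum: "eval2 (sum f A) z = (\<Sum>i\<in>A. eval2 (f i) z)" for f and A :: "nat set" and z
    by (induction A rule: infinite_finite_induct) auto
  have "eval2 p z = (\<Sum>i\<le>degree p. \<Sum>j\<le>degree (Polynomial.coeff p i).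
      coeff2 p i j * (fst z ^ i * snd z ^ j))" for z
    by (subst (1) bipoly_expand) (simp only: sum eval2_simps)
  hence "eval2 p = (\<lambda>z. \<Sum>i\<le>degree p. \<Sum>j\<le>degree (Polynomial.coeff p i).
      coeff2 p i j * (fst z ^ i * snd z ^ j))" by blast
  thus ?thesis by (simp only:) (intro continuous_intros)
qed

text \<open>Passes from the Lebesgue integral to the gauge integral, in which product integrals and
  uniform limits are treated below.\<close>

lemma integral_mu:
  assumes a: "\<bar>a\<bar> < 1"
  shows "(\<integral>z. eval2 p z \<partial>mu a) = integral square (\<lambda>z. weight a z * eval2 p z)"
proof -
  have S: "{-1..1} \<times> {-1..1} = square" by (simp add: cbox_Pair_eq)
  have cont: "continuous_on square (\<lambda>z. weight a z * eval2 p z)"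
    by (intro continuous_intros continuous_on_weight a)
  have "(\<lambda>z. weight a z * indicator square z) \<in> borel_measurable lborel"
    using borel_integrable_compact[OF compact_cbox continuous_on_weight[OF a]]
    by (simp add: mult.commute borel_measurable_integrable)
  moreover have "eval2 p \<in> borel_measurable lborel"
    using borel_measurable_continuous_onI[OF continuous_on_eval2] by simp
  ultimately have "(\<integral>z. eval2 p z \<partial>mu a) = (\<integral>z. (weight a z * indicator square z) *\<^sub>R eval2 p z \<partial>lborel)"
    unfolding mu_def S by (intro integral_density) (auto simp: weight_nonneg[OF a] indicator_def)
  also have "\<dots> = (LINT z : square | lborel. weight a z * eval2 p z)"
    by (simp add: set_lebesgue_integral_def mult_ac)
  also have "\<dots> = integral square (\<lambda>z. weight a z * eval2 p z)"
    using borel_integrable_compact[OF compact_cbox cont]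
    by (intro set_borel_integral_eq_integral) (simp add: set_integrable_def)
  finally show ?thesis .
qed

lemma integral_product:
  fixes f g :: "real \<Rightarrow> real"
  assumes "continuous_on {-1..1} f" "continuous_on {-1..1} g"
  shows "integral square (\<lambda>z. f (fst z) * g (snd z)) = integral {-1..1} f * integral {-1..1} g"
proof -
  have "continuous_on square (\<lambda>z. f (fst z) * g (snd z))"
    by (intro continuous_on_mult continuous_on_compose2[OF assms(1)] continuous_on_compose2[OF assms(2)] continuous_intros)
       (auto simp: cbox_Pair_eq)
  thus ?thesis by (subst integral_prod_continuous) simp_all
qed

section \<open>The functional given by the measure\<close>

definition mu_functional :: "real \<Rightarrow> bipoly \<Rightarrow> real" where
  "mu_functional a p = (\<integral>z. eval2 p z \<partial>mu a)"

lemma mu_functional_linear: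
  assumes a: "\<bar>a\<bar> < 1"
  shows "linear_functional (mu_functional a)"
proof -
  have int: "(\<lambda>z. weight a z * eval2 p z) integrable_on square" for p
    by (intro integrable_continuous continuous_intros continuous_on_weight a)
  show ?thesis
    unfolding linear_functional_def mu_functional_def integral_mu[OF a]
    by (auto simp: distrib_left integral_add[OF int int] mult.left_commute)
qed

text \<open>Finiteness of roots is used twice: in \<open>y\<close> for each fixed \<open>x\<close>,
  and then over the ring of polynomials in \<open>y\<close>, where the constants
  \<open>[:x:]\<close> are infinitely many roots of \<open>p\<close>.\<close>

lemma eval2_eq_0:
  assumes "\<And>x y. \<bar>x\<bar> < 1 \<Longrightarrow> \<bar>y\<bar> < 1 \<Longrightarrow> eval2 p (x, y) = 0"
  shows "p = 0"
proof -
  have inf: "infinite {-1<..<(1::real)}" by (simp add: infinite_Ioo)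
  have "poly p [:x:] = 0" if "x \<in> {-1<..<1}" for x
  proof (rule ccontr)
    assume "poly p [:x:] \<noteq> 0"
    hence "finite {y. poly (poly p [:x:]) y = 0}" by (rule poly_roots_finite)
    moreover have "{-1<..<1} \<subseteq> {y. poly (poly p [:x:]) y = 0}"
      using assms[of x] that by (auto simp: eval2_def abs_less_iff)
    ultimately show False using inf finite_subset by blast
  qed
  hence "(\<lambda>x. [:x:]) ` {-1<..<1} \<subseteq> {q. poly p q = 0}" by auto
  moreover have "infinite ((\<lambda>x. [:x:]) ` {-1<..<(1::real)})"
    using inf by (subst finite_image_iff) (auto simp: inj_on_def)
  ultimately show ?thesis using poly_roots_finite[of p] finite_subset by blast
qed

text \<open>A continuous nonnegative integrand with zero integral vanishes on the square. The weight
  is positive in the interior, so \<open>f\<close> would vanish there.\<close>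

lemma mu_functional_positive_definite:
  assumes a: "\<bar>a\<bar> < 1"
  shows "positive_definite (mu_functional a)"
  unfolding positive_definite_def
proof (intro conjI allI impI mu_functional_linear a)
  fix f :: bipoly assume f: "f \<noteq> 0"
  let ?g = "\<lambda>z. weight a z * eval2 (f\<^sup>2) z"
  have cont: "continuous_on square ?g"
    by (intro continuous_intros continuous_on_weight a)
  have nonneg: "?g z \<ge> 0" if "z \<in> square" for z
    using weight_nonneg[OF a that] by simp
  have "integral square ?g \<noteq> 0"
  proof
    assume 0: "integral square ?g = 0"
    have box: "box (-1, -1) (1, 1::real) \<noteq> ({} :: (real \<times> real) set)"
      using mem_box(1)[of "(0, 0)" "(-1, -1)" "(1, 1::real)"] by (fastforce simp: Basis_prod_def)
    have g0: "?g z = 0" if "z \<in> square" for z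
    proof (rule has_integral_0_cbox_imp_0[OF cont _ _ box that])
      show "(?g has_integral 0) square"
        using 0 integrable_continuous[OF cont] by (metis integrable_integral)
    qed (use nonneg box_subset_cbox in blast)
    have "eval2 f (x, y) = 0" if "\<bar>x\<bar> < 1" "\<bar>y\<bar> < 1" for x y
    proof -
      have "(x, y) \<in> square" using that by (subst square_iff) simp
      from g0[OF this] weight_pos[OF a that] show ?thesis by simp
    qed
    thus False using eval2_eq_0 f by blast
  qed
  moreover have "integral square ?g \<ge> 0"
    using nonneg by (intro integral_nonneg integrable_continuous cont) auto
  ultimately show "mu_functional a (f\<^sup>2) > 0"
    unfolding mu_functional_def integral_mu[OF a] by linarith
qed

text \<open>The Poisson series is integrated term by term, by uniform convergence, and orthogonality
  in \<open>x\<close> keeps only the term \<open>k = n\<close>. The 0 in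
  \<open>eval2 h (0, y)\<close> is arbitrary, as \<open>h\<close> is free of
  \<open>x\<close>.\<close>

lemma mu_functional_cheb:
  assumes a: "\<bar>a\<bar> < 1" and h: "degree h = 0"
  shows "mu_functional a (cheb (Suc n) varx * h) =
    a ^ n * (2 / pi * integral {-1..1} (\<lambda>y. wcheb (Suc n) y * eval2 h (0, y)))"
proof -
  obtain g where g: "h = [:g:]" using h by (rule degree_eq_zeroE)
  have ev: "eval2 h z = poly g (snd z)" for z by (simp add: g eval2_def)
  define u where "u z = cheb (Suc n) (fst z) * poly g (snd z)" for z :: "real \<times> real"
  have cu: "continuous_on square u" unfolding u_def by (intro continuous_intros)
  obtain B where B: "\<And>z. z \<in> square \<Longrightarrow> norm (u z) \<le> B"
    using compact_imp_bounded[OF compact_continuous_image[OF cu compact_cbox]]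
    by (auto simp: bounded_iff)
  define f where "f k z = 4 / pi\<^sup>2 * (a ^ k * (wcheb (Suc k) (fst z) * wcheb (Suc k) (snd z))) * u z" for k z
  have wb: "\<bar>wcheb (Suc k) (fst z)\<bar> * \<bar>wcheb (Suc k) (snd z)\<bar> \<le> 1" if "z \<in> square" for z k
    using that wcheb_bound by (cases z) (auto simp: square_iff intro!: mult_le_one)
  have "norm (f k z) \<le> 4 / pi\<^sup>2 * (\<bar>a\<bar> ^ k * 1) * B" if "z \<in> square" for k z
    unfolding f_def norm_mult
    using B[OF that] wb[OF that] by (intro mult_mono) (auto simp: power_abs abs_mult)
  moreover have "summable (\<lambda>k. 4 / pi\<^sup>2 * (\<bar>a\<bar> ^ k * 1) * B)"
    using a by (intro summable_mult summable_mult2) (simp add: summable_geometric)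
  ultimately have "uniform_limit square (\<lambda>N z. \<Sum>k<N. f k z) (\<lambda>z. \<Sum>k. f k z) sequentially"
    by (rule Weierstrass_m_test)
  moreover have "continuous_on square (\<lambda>z. \<Sum>k<N. f k z)" for N
    unfolding f_def by (intro continuous_intros cu)
  ultimately obtain I J where I: "\<And>N. ((\<lambda>z. \<Sum>k<N. f k z) has_integral I N) square"
    and J: "((\<lambda>z. \<Sum>k. f k z) has_integral J) square" and lim: "I \<longlonglongrightarrow> J"
    by (rule uniform_limit_integral_cbox) auto
  define v where "v = a ^ n * (2 / pi * integral {-1..1} (\<lambda>y. wcheb (Suc n) y * poly g y))"
  have fk: "(f k has_integral (if k = n then v else 0)) square" for k
  proof -
    let ?c = "4 / pi\<^sup>2 * a ^ k"
    have f_eq: "f k = (\<lambda>z. ?c * ((wcheb (Suc k) (fst z) * cheb (Suc n) (fst z)) * (wcheb (Suc k) (snd z) * poly g (snd z))))"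
      by (simp add: f_def u_def fun_eq_iff mult_ac)
    have "integral square (f k) = ?c * (integral {-1..1} (\<lambda>x. wcheb (Suc k) x * cheb (Suc n) x)
        * integral {-1..1} (\<lambda>y. wcheb (Suc k) y * poly g y))"
      unfolding f_eq integral_mult_right
      by (subst integral_product) (auto intro!: continuous_intros)
    also have "\<dots> = (if k = n then v else 0)"
      unfolding integral_cheb_orthogonal v_def by (simp add: power2_eq_square)
    finally have "integral square (f k) = (if k = n then v else 0)" .
    moreover have "f k integrable_on square"
      unfolding f_def by (intro integrable_continuous continuous_intros cu)
    ultimately show ?thesis by (simp add: has_integral_iff)
  qed
  \<comment> \<open>The integrals of the partial sums are constant from \<open>Suc n\<close> on,
    which gives their limit.\<close>
  have "I N = v" if "N > n" for N
  proof -
    have "((\<lambda>z. \<Sum>k<N. f k z) has_integral (\<Sum>k<N. if k = n then v else 0)) square"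
      by (intro has_integral_sum fk) auto
    with I[of N] have "I N = (\<Sum>k<N. if k = n then v else 0)" by (rule has_integral_unique)
    thus ?thesis using that by simp
  qed
  hence "I \<longlonglongrightarrow> v" by (intro tendsto_eventually eventually_at_top_dense[THEN iffD2]) blast
  hence Jv: "J = v" using lim LIMSEQ_unique by blast
  have sum: "(\<Sum>k. f k z) = weight a z * eval2 (cheb (Suc n) varx * h) z" if "z \<in> square" for z
    using that sums_mult2[OF poisson_kernel[OF a], of "fst z" "snd z" "u z"]
    by (cases z) (auto simp: square_iff f_def sums_iff u_def ev eval2_cheb simp del: cheb.simps)
  have "((\<lambda>z. weight a z * eval2 (cheb (Suc n) varx * h) z) has_integral v) square"
    by (rule has_integral_eq[OF sum J[unfolded Jv]])
  thus ?thesis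
    unfolding mu_functional_def integral_mu[OF a] v_def ev by (simp add: integral_unique)
qed

section \<open>Orthonormality of the vectors and conclusion\<close>

lemma lex_poly_orthogonal_less:
  assumes F: "positive_definite F" and "l' \<le> m" "k < n \<or> k = n \<and> l' < l"
  shows "F (lex_poly F n m l * lex_poly F k m l') = 0"
proof -
  have lin: "linear_functional F" using F by (simp add: positive_definite_def)
  show ?thesis
    using assms
    by (intro orthonormal_poly_orthogonal[OF lin lex_poly_orthonormal[OF F]]
        supported_mono[OF orthonormal_poly_supported[OF lex_poly_orthonormal[OF F]]])
       (auto simp: lex_below_def)
qed

lemma gram_lex_vec:
  assumes F: "positive_definite F"
  shows "gram F (lex_vec F n m) (lex_vec F k m) = (if n = k then 1\<^sub>m (m + 1) else 0\<^sub>m (m + 1) (m + 1))"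
proof -
  have "F (lex_poly F n m l * lex_poly F k m l') = (if n = k \<and> l = l' then 1 else 0)"
    if "l \<le> m" "l' \<le> m" for l l'
  proof -
    consider "n = k" "l = l'" | "k < n \<or> k = n \<and> l' < l" | "n < k \<or> n = k \<and> l < l'"
      by linarith
    thus ?thesis
    proof cases
      case 1
      thus ?thesis using lex_poly_orthonormal[OF F, of n l m]
        by (simp add: is_orthonormal_poly_def power2_eq_square)
    next
      case 2
      thus ?thesis using lex_poly_orthogonal_less[OF F that(2) 2] by auto
    next
      case 3
      thus ?thesis using lex_poly_orthogonal_less[OF F that(1) 3] by (auto simp: mult.commute)
    qed
  qed
  thus ?thesis
    by (intro eq_matI) (auto simp: gram_def lex_vec_def)
qed

text \<open>The case \<open>n = 0\<close> of \<open>mu_functional_cheb\<close> evaluates polynomials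
  in \<open>y\<close>. Moving \<open>U\<^sub>n\<close> out of \<open>wcheb\<close> in the general
  case and comparing gives \<open>transfer\<close>.\<close>

lemma coupled_chebyshev_mu:
  assumes a: "\<bar>a\<bar> < 1"
  shows "coupled_chebyshev (mu_functional a) a"
proof
  have w: "wcheb (Suc 0) y * cheb k y = wcheb k y" for k y by (simp add: wcheb_def)
  have y: "mu_functional a h = 2 / pi * integral {-1..1} (\<lambda>y. wcheb (Suc 0) y * eval2 h (0, y))"
    if "degree h = 0" for h
    using mu_functional_cheb[OF a that, of 0] by simp
  show "mu_functional a (cheb (Suc n) varx * h) = a ^ n * mu_functional a (cheb (Suc n) vary * h)"
    if "degree h = 0" for n h
    using y[OF degree_mult_0[OF degree_vary(2) that], of "Suc n"]
    by (simp add: mu_functional_cheb[OF a that] eval2_cheb w mult.assoc[symmetric] del: cheb.simps(3))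
  show "mu_functional a (cheb (Suc n) vary) = (if n = 0 then 1 else 0)" for n
    using y[OF degree_vary(2)[of "Suc n"]] integral_cheb_orthogonal[of 0 n]
    by (simp add: eval2_cheb del: cheb.simps(3))
qed (use a mu_functional_positive_definite in auto)

theorem theorem3p1:
  fixes s :: "nat \<Rightarrow> nat \<Rightarrow> real"
  assumes "\<bar>s 1 1\<bar> < 1"
    and "s 0 0 = 1"
    and "\<And>n. n \<ge> 1 \<Longrightarrow> s (2*n - 1) 0 = 0"
    and "\<And>n. n \<ge> 1 \<Longrightarrow> s (2*n) 0 = 1/2"
    and "\<And>m. m \<ge> 1 \<Longrightarrow> s 0 (2*m - 1) = 0"
    and "\<And>m. m \<ge> 1 \<Longrightarrow> s 0 (2*m) = 1/2"
    and "\<And>n m. n \<ge> 1 \<Longrightarrow> m \<ge> 1 \<Longrightarrow> s (2*n - 1) (2*m - 1) = s 1 1"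
    and "\<And>n m. n \<ge> 1 \<Longrightarrow> m \<ge> 1 \<Longrightarrow> s (2*n - 1) (2*m) = 0"
    and "\<And>n m. n \<ge> 1 \<Longrightarrow> m \<ge> 1 \<Longrightarrow> s (2*n) (2*m - 1) = 0"
    and "\<And>n m. n \<ge> 1 \<Longrightarrow> m \<ge> 1 \<Longrightarrow> s (2*n) (2*m) = 1/2"
  shows "(\<exists>!F. positive_definite F \<and> is_parameter_array F s) \<and>
    (\<forall>F. positive_definite F \<and> is_parameter_array F s \<longrightarrow>
      (\<forall>n k m. gram (\<lambda>p. \<integral>z. eval2 p z \<partial>mu (s 1 1)) (lex_vec F n m) (lex_vec F k m) =
        (if n = k then 1\<^sub>m (m + 1) else 0\<^sub>m (m + 1) (m + 1))))"
proof -
  let ?F = "mu_functional (s 1 1)"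
  have params:
    "s (2 * n + 1) 0 = 0" "s (2 * n + 2) 0 = 1/2" "s 0 (2 * m + 1) = 0" "s 0 (2 * m + 2) = 1/2"
    "s (2 * n + 1) (2 * m + 1) = s 1 1" "s (2 * n + 1) (2 * m + 2) = 0"
    "s (2 * n + 2) (2 * m + 1) = 0" "s (2 * n + 2) (2 * m + 2) = 1/2" for n m
    using assms(3,4)[of "Suc n"] assms(5,6)[of "Suc m"] assms(7-10)[of "Suc n" "Suc m"] by simp_all
  interpret coupled_chebyshev ?F "s 1 1"
    using assms(1) by (rule coupled_chebyshev_mu)
  interpret chebyshev_model ?F s "s 1 1"
    using assms(2) params by unfold_locales
  \<comment> \<open>Both claims reduce to \<open>?F\<close>: it is the only functional with these
    parameters, and its Gram matrices are the required integrals.\<close>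
  have "positive_definite F \<and> is_parameter_array F s \<longleftrightarrow> F = ?F" for F
    using functional_unique pd is_parameter_array by blast
  thus ?thesis
    using gram_lex_vec[OF pd] by (simp add: mu_functional_def[abs_def])
qed

end
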